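(* Let $k\ge 2$ be an integer. (a) Let $\alpha>k!$ be a constant, and let $p=p(n)$, $q=q(n)\in[0,1]$ satisfy $pq\ge \alpha\log n/n^{k-1}$. Let $G_1\in\mathcal G(n,k,p)$ and $G_2\in\mathcal G(n,k,q)$ be independent random $k$-uniform hypergraphs of order $n$. Then the probability that $G_1$ and $G_2$ can be packed is $o(1)$ as $n\to\infty$. (b) Consequently, the threshold density for two random $k$-uniform hypergraphs to be unpackable is $\Theta\bigl(\sqrt{\log n/n^{k-1}}\bigr)$: there are constants $0<c<C$, depending only on $k$, such that for independent $G_1,G_2\in\mathcal G(n,k,p)$ with $p=p(n)\in[0,1]$, with high probability $G_1$ and $G_2$ can be packed if $p\le c\sqrt{\log n/n^{k-1}}$ for all large $n$, and with high probability $G_1$ and $G_2$ cannot be packed if $p\ge C\sqrt{\log n/n^{k-1}}$ for all large $n$.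
   Context: For integers $k,n$ and $p\in[0,1]$, $\mathcal G(n,k,p)$ denotes the random $k$-uniform hypergraph on $n$ vertices in which each of the $\binom nk$ possible edges is present independently with probability $p$. Two $k$-uniform hypergraphs $G_1,G_2$ of order $n$ (i.e. with $n$ vertices) can be packed if they can be placed onto the same vertex set so that their edge sets are disjoint; equivalently, there is a bijection $\phi:V(G_1)\to V(G_2)$ such that no edge of $G_1$ is mapped by $\phi$ to an edge of $G_2$. "With high probability" means with probability $1-o(1)$ as $n\to\infty$. $\log$ is the natural logarithm. *)

theory Defs
  imports "HOL-Probability.Probability"
begin

definition k_subsets :: "nat \<Rightarrow> nat \<Rightarrow> nat set set" where
  "k_subsets n k = {e. e \<subseteq> {..<n} \<and> card e = k}"

text \<open>
  The random hypergraph \<open>G(n,k,p)\<close> on the vertex set \<open>{..<n}\<close>, given as the law of its edge set.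
  Note that \<^const>\<open>bernoulli_pmf\<close> truncates its parameter to \<open>[0,1]\<close>, so this is meaningful only
  for \<open>0 \<le> p \<le> 1\<close>.
\<close>

definition random_hypergraph :: "nat \<Rightarrow> nat \<Rightarrow> real \<Rightarrow> nat set set pmf" where
  "random_hypergraph n k p =
     map_pmf (\<lambda>f. {e \<in> k_subsets n k. f e})
       (Pi_pmf (k_subsets n k) False (\<lambda>_. bernoulli_pmf p))"

definition packable :: "'a set \<Rightarrow> 'a set set \<Rightarrow> 'b set \<Rightarrow> 'b set set \<Rightarrow> bool" where
  "packable V1 E1 V2 E2 \<longleftrightarrow> (\<exists>\<phi>. bij_betw \<phi> V1 V2 \<and> (\<forall>e\<in>E1. \<phi> ` e \<notin> E2))"

text \<open>
  Two independent random hypergraphs: their joint law is the product of their laws.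
\<close>

definition random_hypergraph_pair ::
    "nat \<Rightarrow> nat \<Rightarrow> real \<Rightarrow> real \<Rightarrow> (nat set set \<times> nat set set) pmf" where
  "random_hypergraph_pair n k p q = pair_pmf (random_hypergraph n k p) (random_hypergraph n k q)"

end

theory Submission
  imports Defs "HOL-Real_Asymp.Real_Asymp"
begin

text \<open>
  \<^bold>\<open>Dense pairs.\<close> For a fixed bijection each of the \<open>n choose k\<close> edges survives with probability
  \<open>1 - p q\<close>, independently, so the expected number of packings is \<open>n! (1 - p q) ^ (n choose k)\<close>.
  Since \<open>p q (n choose k)\<close> is about \<open>(\<alpha> / k!) n ln n\<close>, which exceeds \<open>ln (n!)\<close> by a constant factor,
  this tends to 0.

  \<^bold>\<open>Sparse pairs.\<close> Let \<open>k = l + 1\<close> and \<open>p \<le> P = sqrt (ln n / n ^ l) / 20\<close>. Both hypergraphs are revealed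
  one vertex at a time: the edges that appear when vertex \<open>t\<close> arrives are those through \<open>t\<close>, and their
  traces \<open>A\<close> and \<open>B\<close> on \<open>{..<t}\<close> are fresh random \<open>l\<close>-uniform hypergraphs, independent of the past.
  Given a packing \<open>\<phi>\<close> of the hypergraphs on \<open>{..<t}\<close>, one looks for an old vertex \<open>u\<close> such that the new
  vertex can be mapped to \<open>\<phi> u\<close> and \<open>u\<close> to the new vertex. This works if \<open>A\<close> and \<open>B\<close> together avoid a
  set of obstacles of \<open>u\<close>, whose size is at most twice the maximum degree (hence of order \<open>P n ^ l\<close>), and if
  no set of \<open>A\<close> through \<open>u\<close> is mapped into \<open>B\<close>. A single \<open>u\<close> avoids its obstacles with probability at least
  about \<open>n powr (-0.03)\<close>, and there are \<open>t\<close> candidates. If the candidates were independent, all of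
  them would fail only with tiny probability.

  They are not independent, since obstacle sets of different candidates overlap; but each
  coordinate is an obstacle of few candidates. Lemma \<open>random_subset_hits_all\<close> turns this into a bound of the
  independent kind: candidates are tested successively, each time choosing one that is not yet
  spoiled by the elements found so far. Lemma \<open>extension_failure_prob\<close> concludes that one
  extension fails with probability \<open>o(1 / n)\<close> provided that the degrees are bounded, and
  \<open>unpackable_prob_Suc_le\<close> turns this into a recursion in \<open>t\<close>. The recursion starts at
  \<open>t\<close> about \<open>n powr 0.45\<close>, where the identity is a packing with high probability.
\<close>

section \<open>Random subsets of a finite set\<close>

definition random_subset :: "'a set \<Rightarrow> real \<Rightarrow> 'a set pmf" where
  "random_subset S p = map_pmf (\<lambda>f. {x \<in> S. f x}) (Pi_pmf S False (\<lambda>_. bernoulli_pmf p))"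

lemma random_hypergraph_eq: "random_hypergraph n k p = random_subset (k_subsets n k) p"
  by (simp add: random_hypergraph_def random_subset_def)

lemma random_subset_empty [simp]: "random_subset {} p = return_pmf {}"
  by (simp add: random_subset_def)

lemma set_random_subset: "set_pmf (random_subset S p) \<subseteq> Pow S"
  by (auto simp: random_subset_def)

lemma finite_set_random_subset: "finite S \<Longrightarrow> finite (set_pmf (random_subset S p))"
  by (rule finite_subset[OF set_random_subset]) simp

lemma integrable_random_subset [simp]:
  fixes f :: "'a set \<Rightarrow> real"
  shows "finite S \<Longrightarrow> integrable (measure_pmf (random_subset S p)) f"
  by (intro integrable_measure_pmf_finite finite_set_random_subset)

lemma random_subset_union:
  assumes "finite S" "finite T" "S \<inter> T = {}"
  shows "random_subset (S \<union> T) p =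
    map_pmf (\<lambda>(A, B). A \<union> B) (pair_pmf (random_subset S p) (random_subset T p))"
  using assms
  unfolding random_subset_def
  by (auto simp: Pi_pmf_union pair_map_pmf1 pair_map_pmf2 map_pmf_comp case_prod_unfold
      intro!: map_pmf_cong)

lemma random_subset_image:
  fixes g :: "'c \<Rightarrow> 'd"
  assumes "finite S" "inj_on g S"
  shows "random_subset (g ` S) p = map_pmf (image g) (random_subset S p)"
  using assms
proof (induction S rule: finite_induct)
  case (insert x S)
  have single: "random_subset {y} p = map_pmf (\<lambda>b. if b then {y} else {}) (bernoulli_pmf p)"
    for y :: 'd
    by (auto simp: random_subset_def Pi_pmf_singleton map_pmf_comp intro!: map_pmf_cong split: if_splits)
  have single': "random_subset {y} p = map_pmf (\<lambda>b. if b then {y} else {}) (bernoulli_pmf p)"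
    for y :: 'c
    by (auto simp: random_subset_def Pi_pmf_singleton map_pmf_comp intro!: map_pmf_cong split: if_splits)
  have *: "random_subset ({g x} \<union> g ` S) p =
      map_pmf (\<lambda>(A, B). A \<union> B) (pair_pmf (random_subset {g x} p) (random_subset (g ` S) p))"
    by (rule random_subset_union) (use insert in auto)
  have **: "random_subset ({x} \<union> S) p =
      map_pmf (\<lambda>(A, B). A \<union> B) (pair_pmf (random_subset {x} p) (random_subset S p))"
    by (rule random_subset_union) (use insert in auto)
  have "random_subset (g ` insert x S) p = map_pmf (\<lambda>(b, A). (if b then {g x} else {}) \<union> g ` A)
      (pair_pmf (bernoulli_pmf p) (random_subset S p))"
    using insert * by (simp add: single pair_map_pmf1 pair_map_pmf2 map_pmf_comp case_prod_unfold)
  moreover have "random_subset (insert x S) p = map_pmf (\<lambda>(b, A). (if b then {x} else {}) \<union> A)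
      (pair_pmf (bernoulli_pmf p) (random_subset S p))"
    using ** by (simp add: single' pair_map_pmf1 map_pmf_comp case_prod_unfold)
  ultimately show ?case
    by (simp add: map_pmf_comp case_prod_unfold image_Un if_distrib[of "image g"] cong: if_cong)
qed auto

text \<open>
  This generating function is the only computation with the distribution: \<open>y = 0\<close> gives the probability
  of avoiding \<open>Y\<close>, \<open>y = 2\<close> gives exponential tail bounds, and integrating it over a random \<open>Y\<close>
  handles the intersection of two independent random sets.
\<close>

lemma expectation_power_card_random_subset:
  assumes "finite S" "0 \<le> p" "p \<le> 1" "0 \<le> y"
  shows "measure_pmf.expectation (random_subset S p) (\<lambda>A. y ^ card (A \<inter> Y)) = (1 - p + p * y) ^ card (S \<inter> Y)"
proof -
  have eq: "y ^ card ({x \<in> S. f x} \<inter> Y) = (\<Prod>x\<in>S. if x \<in> Y \<and> f x then y else 1)" for f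
  proof -
    have "(\<Prod>x\<in>S. if x \<in> Y \<and> f x then y else 1) = (\<Prod>x\<in>{x\<in>S. x \<in> Y \<and> f x}. y)"
      by (rule prod.inter_filter[symmetric]) (rule assms)
    also have "{x\<in>S. x \<in> Y \<and> f x} = {x \<in> S. f x} \<inter> Y" by auto
    finally show ?thesis by simp
  qed
  have "measure_pmf.expectation (random_subset S p) (\<lambda>A. y ^ card (A \<inter> Y)) =
    measure_pmf.expectation (Pi_pmf S False (\<lambda>_. bernoulli_pmf p))
      (\<lambda>f. \<Prod>x\<in>S. (if x \<in> Y \<and> f x then y else 1))"
    by (simp add: random_subset_def eq)
  also have "\<dots> = (\<Prod>x\<in>S. measure_pmf.expectation (bernoulli_pmf p) (\<lambda>b. if x \<in> Y \<and> b then y else 1))"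
    by (rule expectation_prod_Pi_pmf) (use assms in \<open>auto intro: integrable_measure_pmf_finite\<close>)
  also have "\<dots> = (\<Prod>x\<in>S. if x \<in> Y then 1 - p + p * y else 1)"
    by (rule prod.cong) (use assms in auto)
  also have "\<dots> = (1 - p + p * y) ^ card (S \<inter> Y)"
    using assms by (simp add: prod.inter_restrict[symmetric])
  finally show ?thesis .
qed

lemma prob_le_expectation:
  fixes f :: "'a \<Rightarrow> real"
  assumes "finite (set_pmf M)" "\<And>x. x \<in> set_pmf M \<Longrightarrow> 0 \<le> f x"
    "\<And>x. x \<in> set_pmf M \<Longrightarrow> x \<in> E \<Longrightarrow> 1 \<le> f x"
  shows "measure_pmf.prob M E \<le> measure_pmf.expectation M f"
proof -
  have "measure_pmf.prob M E = measure_pmf.expectation M (indicator E)" by simp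
  also have "\<dots> \<le> measure_pmf.expectation M f"
    by (rule integral_mono_AE) (use assms in \<open>auto intro!: integrable_measure_pmf_finite AE_pmfI simp: indicator_def\<close>)
  finally show ?thesis .
qed

lemma random_subset_disjoint_prob:
  assumes "finite S" "0 \<le> p" "p \<le> 1"
  shows "measure_pmf.prob (random_subset S p) {A. A \<inter> Y = {}} = (1 - p) ^ card (S \<inter> Y)"
proof -
  have "measure_pmf.prob (random_subset S p) {A. A \<inter> Y = {}}
     = measure_pmf.expectation (random_subset S p) (indicator {A. A \<inter> Y = {}})" by simp
  also have "\<dots> = measure_pmf.expectation (random_subset S p) (\<lambda>A. 0 ^ card (A \<inter> Y))"
  proof (intro integral_cong_AE AE_pmfI)
    fix A assume "A \<in> set_pmf (random_subset S p)"
    hence "A \<subseteq> S" using set_random_subset[of S p] by auto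
    hence "finite (A \<inter> Y)" using assms(1) by (auto intro: finite_subset)
    thus "indicator {A. A \<inter> Y = {}} A = (0::real) ^ card (A \<inter> Y)"
      by (simp add: indicator_def power_0_left)
  qed auto
  finally show ?thesis using expectation_power_card_random_subset[OF assms, of 0 Y] by simp
qed

lemma random_subset_tail:
  assumes "finite S" "0 \<le> p" "p \<le> 1" "card (S \<inter> Y) \<le> N"
  shows "measure_pmf.prob (random_subset S p) {A. h \<le> card (A \<inter> Y)} \<le> exp (p * N) / 2 ^ h"
proof -
  have "measure_pmf.prob (random_subset S p) {A. h \<le> card (A \<inter> Y)}
     \<le> measure_pmf.expectation (random_subset S p) (\<lambda>A. 2 ^ card (A \<inter> Y) / 2 ^ h)"
    by (rule prob_le_expectation) (use assms in \<open>auto simp: finite_set_random_subset\<close>)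
  also have "\<dots> = (1 + p) ^ card (S \<inter> Y) / 2 ^ h"
    using expectation_power_card_random_subset[OF assms(1-3), of 2 Y] by (simp add: add.commute)
  also have "\<dots> \<le> exp p ^ N / 2 ^ h"
  proof (intro divide_right_mono)
    have "(1 + p) ^ card (S \<inter> Y) \<le> exp p ^ card (S \<inter> Y)"
      by (intro power_mono) (use assms in auto)
    also have "\<dots> \<le> exp p ^ N" by (rule power_increasing) (use assms in auto)
    finally show "(1 + p) ^ card (S \<inter> Y) \<le> exp p ^ N" .
  qed auto
  also have "exp p ^ N = exp (p * N)" by (simp add: exp_of_nat_mult[symmetric] mult.commute)
  finally show ?thesis .
qed

lemma prob_pair_pmf:
  "measure_pmf.prob (pair_pmf M N) E
     = measure_pmf.expectation M (\<lambda>x. measure_pmf.prob N {y. (x, y) \<in> E})"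
proof -
  have pair: "pair_pmf M N = bind_pmf M (\<lambda>x. map_pmf (Pair x) N)"
    unfolding pair_pmf_def map_pmf_def by (rule refl)
  have "ennreal (measure_pmf.prob (pair_pmf M N) E) = emeasure (pair_pmf M N) E"
    by (rule measure_pmf.emeasure_eq_measure[symmetric])
  also have "\<dots> = (\<integral>\<^sup>+x. emeasure (map_pmf (Pair x) N) E \<partial>M)"
    by (subst pair, subst emeasure_bind_pmf) (rule refl)
  also have "\<dots> = (\<integral>\<^sup>+x. ennreal (measure_pmf.prob N {y. (x, y) \<in> E}) \<partial>M)"
    by (simp add: measure_pmf.emeasure_eq_measure vimage_def)
  also have "\<dots> = ennreal (measure_pmf.expectation M (\<lambda>x. measure_pmf.prob N {y. (x, y) \<in> E}))"
    by (intro nn_integral_eq_integral measure_pmf.integrable_const_bound[where B=1]) auto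
  finally show ?thesis by (simp add: Bochner_Integration.integral_nonneg)
qed

lemma expectation_power_card_Int_pair:
  assumes "finite S" "0 \<le> p" "p \<le> 1" "0 \<le> q" "q \<le> 1" "0 \<le> y"
  shows "measure_pmf.expectation (random_subset S p) (\<lambda>A.
     measure_pmf.expectation (random_subset S q) (\<lambda>B. y ^ card (B \<inter> A))) = (1 - p * q * (1 - y)) ^ card S"
proof -
  have "measure_pmf.expectation (random_subset S p) (\<lambda>A.
     measure_pmf.expectation (random_subset S q) (\<lambda>B. y ^ card (B \<inter> A)))
    = measure_pmf.expectation (random_subset S p) (\<lambda>A. (1 - q + q * y) ^ card (A \<inter> S))"
    using assms by (subst expectation_power_card_random_subset) (auto simp: Int_commute)
  also have "\<dots> = (1 - p + p * (1 - q + q * y)) ^ card (S \<inter> S)"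
    using assms by (intro expectation_power_card_random_subset) (auto)
  finally show ?thesis by (simp add: algebra_simps)
qed

lemma random_subset_pair_disjoint_prob:
  assumes "finite S" "0 \<le> p" "p \<le> 1" "0 \<le> q" "q \<le> 1"
  shows "measure_pmf.prob (pair_pmf (random_subset S p) (random_subset S q)) {(A, B). A \<inter> B = {}} = (1 - p * q) ^ card S"
proof -
  have "measure_pmf.prob (pair_pmf (random_subset S p) (random_subset S q)) {(A, B). A \<inter> B = {}}
    = measure_pmf.expectation (random_subset S p) (\<lambda>A. measure_pmf.prob (random_subset S q) {B. B \<inter> A = {}})"
    by (simp add: prob_pair_pmf Int_commute)
  also have "\<dots> = measure_pmf.expectation (random_subset S p) (\<lambda>A.
     measure_pmf.expectation (random_subset S q) (\<lambda>B. 0 ^ card (B \<inter> A)))"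
    using assms by (simp add: random_subset_disjoint_prob expectation_power_card_random_subset)
  finally show ?thesis using expectation_power_card_Int_pair[OF assms, of 0] by simp
qed

lemma random_subset_pair_tail:
  assumes "finite S" "0 \<le> p" "p \<le> 1" "0 \<le> q" "q \<le> 1" "card S \<le> N"
  shows "measure_pmf.prob (pair_pmf (random_subset S p) (random_subset S q)) {(A, B). h \<le> card (A \<inter> B)} \<le> exp (p * q * N) / 2 ^ h"
proof -
  have "measure_pmf.prob (pair_pmf (random_subset S p) (random_subset S q)) {(A, B). h \<le> card (A \<inter> B)}
    = measure_pmf.expectation (random_subset S p) (\<lambda>A. measure_pmf.prob (random_subset S q) {B. h \<le> card (B \<inter> A)})"
    by (simp add: prob_pair_pmf Int_commute)
  also have "\<dots> \<le> measure_pmf.expectation (random_subset S p) (\<lambda>A.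
     measure_pmf.expectation (random_subset S q) (\<lambda>B. 2 ^ card (B \<inter> A) / 2 ^ h))"
    by (intro integral_mono integrable_random_subset prob_le_expectation)
      (use assms in \<open>auto simp: finite_set_random_subset\<close>)
  also have "\<dots> = (1 + p * q) ^ card S / 2 ^ h"
    using expectation_power_card_Int_pair[OF assms(1-5), of 2] by simp
  also have "\<dots> \<le> exp (p * q) ^ N / 2 ^ h"
  proof (intro divide_right_mono)
    have "(1 + p * q) ^ card S \<le> exp (p * q) ^ card S"
      by (intro power_mono) (use assms in auto)
    also have "\<dots> \<le> exp (p * q) ^ N" by (rule power_increasing) (use assms in auto)
    finally show "(1 + p * q) ^ card S \<le> exp (p * q) ^ N" .
  qed auto
  also have "exp (p * q) ^ N = exp (p * q * N)" by (simp add: exp_of_nat_mult[symmetric] mult.commute)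
  finally show ?thesis .
qed

section \<open>Families of sets that a random subset is unlikely to hit completely\<close>

text \<open>
  The random set is revealed only where needed. Reveal it on \<open>T u\<close> for some \<open>u\<close>; with probability at least
  \<open>(1 - p) ^ d\<close> nothing is found and \<open>T u\<close> is not hit. Otherwise the elements found spoil at most \<open>D\<close> indices
  each; drop those and continue with another index, on whose set the unrevealed part is still fresh.
  As long as at most \<open>h\<close> elements have been found, an unspoiled index remains because
  \<open>h * D < card U\<close>. So all sets are hit only if \<open>m\<close> successive tests fail, which is the first summand,
  or if more than \<open>h\<close> elements are found in \<open>m\<close> tests, which is the second one by Markov's inequality
  for 2 to the number of elements found. In the induction on \<open>m\<close>, \<open>h\<close> is the number of elements that may
  still be found.
\<close>

lemma random_subset_hits_all:
  fixes T :: "'u \<Rightarrow> 'a set"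
  assumes "finite S" "finite U" "0 \<le> p" "p \<le> 1"
    and "\<And>u. u \<in> U \<Longrightarrow> card (S \<inter> T u) \<le> d"
    and "\<And>s. s \<in> S \<Longrightarrow> card {u \<in> U. s \<in> T u} \<le> D"
    and "h * D < card U"
  shows "measure_pmf.prob (random_subset S p) {A. \<forall>u\<in>U. A \<inter> T u \<noteq> {}}
           \<le> (1 - (1 - p) ^ d) ^ m + ((1 + p) ^ d) ^ m / 2 ^ h"
  using assms
proof (induction m arbitrary: S U h)
  case 0
  have "measure_pmf.prob (random_subset S p) {A. \<forall>u\<in>U. A \<inter> T u \<noteq> {}} \<le> 1" by simp
  also have "1 \<le> (1 - (1 - p) ^ d) ^ 0 + ((1 + p) ^ d) ^ 0 / (2::real) ^ h" by simp
  finally show ?case .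
next
  case (Suc m)
  define q where "q = (1 - p) ^ d"
  define M where "M = (1 + p) ^ d"
  have q: "0 \<le> q" "q \<le> 1" and M: "0 \<le> M" using Suc.prems by (auto simp: q_def M_def power_le_one)
  from Suc.prems(7) obtain u where u: "u \<in> U" by (cases "U = {}") auto
  define R where "R = S \<inter> T u"
  define V where "V H = {v \<in> U. H \<inter> T v = {}}" for H
  define f where "f H = (1 - q) ^ m * (1 - indicator {H. H \<inter> R = {}} H) + M ^ m / 2 ^ h * 2 ^ card (H \<inter> R)" for H
  have fin: "finite R" "finite (S - R)" using Suc.prems by (auto simp: R_def)
  have cardR: "card R \<le> d" unfolding R_def by (rule Suc.prems(5)[OF u])
  have split: "random_subset S p = map_pmf (\<lambda>(A, B). A \<union> B) (pair_pmf (random_subset R p) (random_subset (S - R) p))"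
    using random_subset_union[OF fin, of p] by (simp add: R_def Un_Diff_Int Int_Un_distrib Un_commute)
  \<comment> \<open>\<open>H\<close> is what the test of \<open>u\<close> finds, and \<open>V H\<close> are the indices that it leaves unspoiled.\<close>
  have bound: "measure_pmf.prob (random_subset (S - R) p) {A. \<forall>v\<in>U. (H \<union> A) \<inter> T v \<noteq> {}} \<le> f H"
    if H: "H \<subseteq> R" for H
  proof (cases "H = {}")
    case True
    have "measure_pmf.prob (random_subset (S - R) p) {A. \<forall>v\<in>U. (H \<union> A) \<inter> T v \<noteq> {}}
      \<le> measure_pmf.prob (random_subset (S - R) p) {}"
    proof (rule measure_pmf.finite_measure_mono_AE)
      show "AE A in random_subset (S - R) p. A \<in> {A. \<forall>v\<in>U. (H \<union> A) \<inter> T v \<noteq> {}} \<longrightarrow> A \<in> {}"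
        using set_random_subset[of "S - R" p] u True by (fastforce intro!: AE_pmfI simp: R_def)
    qed auto
    also have "\<dots> \<le> f H" using q M by (auto simp: f_def indicator_def)
    finally show ?thesis .
  next
    case False
    let ?x = "card H"
    have HR: "H \<inter> R = H" and finH: "finite H" using H fin finite_subset by auto
    have fH: "f H = (1 - q) ^ m + M ^ m / 2 ^ h * 2 ^ ?x" using False HR by (simp add: f_def)
    show ?thesis
    proof (cases "?x \<le> h")
      case True
      have "card (U - V H) = card (\<Union>s\<in>H. {v \<in> U. s \<in> T v})"
        by (rule arg_cong[where f = card]) (auto simp: V_def)
      also have "\<dots> \<le> (\<Sum>s\<in>H. card {v \<in> U. s \<in> T v})" by (rule card_UN_le[OF finH])
      also have "\<dots> \<le> (\<Sum>s\<in>H. D)"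
        by (rule sum_mono, rule Suc.prems(6)) (use H in \<open>auto simp: R_def\<close>)
      finally have "card (U - V H) \<le> ?x * D" by simp
      moreover have "card U = card (U - V H) + card (V H)"
        using Suc.prems(2) by (subst card_Un_disjoint[symmetric]) (auto simp: V_def intro!: arg_cong[where f=card])
      ultimately have "h * D < ?x * D + card (V H)"
        using Suc.prems(7) by linarith
      moreover have "?x * D \<le> h * D" using True by (rule mult_le_mono1)
      ultimately have "(h - ?x) * D < card (V H)"
        unfolding diff_mult_distrib by linarith
      hence "measure_pmf.prob (random_subset (S - R) p) {A. \<forall>v\<in>V H. A \<inter> T v \<noteq> {}}
           \<le> (1 - q) ^ m + M ^ m / 2 ^ (h - ?x)"
        unfolding q_def M_def
      proof (intro Suc.IH)
        fix v assume "v \<in> V H"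
        hence "v \<in> U" by (simp add: V_def)
        have "card ((S - R) \<inter> T v) \<le> card (S \<inter> T v)"
          by (rule card_mono) (use Suc.prems in auto)
        thus "card ((S - R) \<inter> T v) \<le> d" using Suc.prems(5)[OF \<open>v \<in> U\<close>] by simp
      next
        fix s assume s: "s \<in> S - R"
        have "card {v \<in> V H. s \<in> T v} \<le> card {v \<in> U. s \<in> T v}"
          by (rule card_mono) (use Suc.prems in \<open>auto simp: V_def\<close>)
        thus "card {v \<in> V H. s \<in> T v} \<le> D" using Suc.prems(6)[of s] s by simp
      qed (use Suc.prems in \<open>auto simp: V_def\<close>)
      also have "\<dots> = f H" using True by (simp add: fH power_diff)
      finally have *: "measure_pmf.prob (random_subset (S - R) p) {A. \<forall>v\<in>V H. A \<inter> T v \<noteq> {}} \<le> f H" .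
      have "measure_pmf.prob (random_subset (S - R) p) {A. \<forall>v\<in>U. (H \<union> A) \<inter> T v \<noteq> {}}
         \<le> measure_pmf.prob (random_subset (S - R) p) {A. \<forall>v\<in>V H. A \<inter> T v \<noteq> {}}"
        by (rule measure_pmf.finite_measure_mono) (auto simp: V_def)
      with * show ?thesis by simp
    next
      case False
      \<comment> \<open>Here the allowance \<open>h\<close> is used up; the second summand alone is then at least 1.\<close>
      have "1 \<le> M" using Suc.prems by (simp add: M_def one_le_power)
      have "1 \<le> M ^ m * (2 ^ ?x / 2 ^ h)"
      proof (rule order_trans[of _ "1 * 1"], simp, rule mult_mono)
        show "1 \<le> M ^ m" using \<open>1 \<le> M\<close> by (rule one_le_power)
        show "1 \<le> (2::real) ^ ?x / 2 ^ h" using False by (simp add: power_increasing)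
      qed (use M in auto)
      hence "1 \<le> f H" using q by (simp add: fH add_increasing)
      thus ?thesis by (rule order_trans[rotated]) simp
    qed
  qed
  have int: "integrable (measure_pmf (random_subset R p)) g" for g :: "'a set \<Rightarrow> real"
    using fin by simp
  have "measure_pmf.prob (random_subset S p) {A. \<forall>u\<in>U. A \<inter> T u \<noteq> {}}
    = measure_pmf.expectation (random_subset R p) (\<lambda>H.
        measure_pmf.prob (random_subset (S - R) p) {A. \<forall>v\<in>U. (H \<union> A) \<inter> T v \<noteq> {}})"
    by (simp add: split prob_pair_pmf vimage_def case_prod_unfold)
  also have "\<dots> \<le> measure_pmf.expectation (random_subset R p) f"
    by (rule integral_mono_AE[OF int int])
      (use set_random_subset[of R p] bound in \<open>auto intro!: AE_pmfI\<close>)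
  also have "\<dots> = (1 - q) ^ m * (1 - measure_pmf.prob (random_subset R p) {H. H \<inter> R = {}})
      + M ^ m / 2 ^ h * measure_pmf.expectation (random_subset R p) (\<lambda>H. 2 ^ card (H \<inter> R))"
    unfolding f_def by (simp add: int del: indicator_simps)
  also have "\<dots> = (1 - q) ^ m * (1 - (1 - p) ^ card R) + M ^ m / 2 ^ h * (1 + p) ^ card R"
    using Suc.prems fin
    by (simp add: random_subset_disjoint_prob expectation_power_card_random_subset add.commute)
  also have "\<dots> \<le> (1 - q) ^ m * (1 - q) + M ^ m / 2 ^ h * M"
  proof -
    have "q \<le> (1 - p) ^ card R" unfolding q_def
      by (rule power_decreasing) (use Suc.prems cardR in auto)
    moreover have "(1 + p) ^ card R \<le> M" unfolding M_def
      by (rule power_increasing) (use Suc.prems cardR in auto)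
    ultimately show ?thesis using q M by (intro add_mono mult_left_mono) auto
  qed
  also have "\<dots> = (1 - (1 - p) ^ d) ^ Suc m + ((1 + p) ^ d) ^ Suc m / 2 ^ h"
    by (simp add: q_def M_def mult.commute)
  finally show ?case .
qed

section \<open>Hypergraphs grown one vertex at a time\<close>

lemma finite_k_subsets [simp]: "finite (k_subsets n k)"
  by (rule finite_subset[of _ "Pow {..<n}"]) (auto simp: k_subsets_def)

lemma card_k_subsets: "card (k_subsets n k) = n choose k"
  unfolding k_subsets_def using n_subsets[of "{..<n}" k] by simp

lemma card_k_subsets_le: "card (k_subsets n k) \<le> n ^ k"
  by (cases "k \<le> n") (auto simp: card_k_subsets binomial_le_pow binomial_eq_0)

lemma image_k_subsets:
  assumes "bij_betw \<phi> {..<n} {..<n}"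
  shows "bij_betw (image \<phi>) (k_subsets n k) (k_subsets n k)"
proof -
  have inj: "inj_on \<phi> {..<n}" and im: "\<phi> ` {..<n} = {..<n}" using assms by (auto simp: bij_betw_def)
  have inj': "inj_on (image \<phi>) (k_subsets n k)"
    by (rule inj_onI) (use inj in \<open>auto simp: k_subsets_def inj_on_image_eq_iff\<close>)
  have "\<phi> ` e \<in> k_subsets n k" if "e \<in> k_subsets n k" for e
    using that im card_image[OF inj_on_subset[OF inj, of e]] by (auto simp: k_subsets_def)
  hence "image \<phi> ` k_subsets n k \<subseteq> k_subsets n k" by blast
  hence "image \<phi> ` k_subsets n k = k_subsets n k"
    by (rule endo_inj_surj[OF finite_k_subsets _ inj'])
  with inj' show ?thesis by (simp add: bij_betw_def)
qed

lemma k_subsets_Suc_Suc: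
  "k_subsets (Suc t) (Suc l) = k_subsets t (Suc l) \<union> insert t ` k_subsets t l"
proof (intro equalityI subsetI)
  fix e assume e: "e \<in> k_subsets (Suc t) (Suc l)"
  show "e \<in> k_subsets t (Suc l) \<union> insert t ` k_subsets t l"
  proof (cases "t \<in> e")
    case True
    have "finite e" using e finite_subset[of e "{..<Suc t}"] by (auto simp: k_subsets_def)
    moreover have "e - {t} \<subseteq> {..<t}" "card e = Suc l"
      using e unfolding k_subsets_def lessThan_Suc by blast+
    ultimately have "e - {t} \<in> k_subsets t l"
      using True by (simp add: k_subsets_def card_Diff_singleton)
    moreover have "e = insert t (e - {t})" using True by blast
    ultimately show ?thesis by blast
  next
    case False
    hence "e \<in> k_subsets t (Suc l)" using e unfolding k_subsets_def lessThan_Suc by blast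
    thus ?thesis by blast
  qed
next
  fix e assume e: "e \<in> k_subsets t (Suc l) \<union> insert t ` k_subsets t l"
  from e consider "e \<in> k_subsets t (Suc l)" | z where "z \<in> k_subsets t l" "e = insert t z"
    by blast
  thus "e \<in> k_subsets (Suc t) (Suc l)"
  proof cases
    case 1
    thus ?thesis unfolding k_subsets_def by (auto simp: lessThan_Suc)
  next
    case 2
    hence z: "z \<subseteq> {..<t}" "card z = l" by (auto simp: k_subsets_def)
    hence "finite z" "t \<notin> z" using finite_subset by auto
    thus ?thesis using z 2(2) by (auto simp: k_subsets_def)
  qed
qed

text \<open>
  The edges through the last vertex are as good as an independent \<open>l\<close>-uniform random hypergraph on the
  other vertices. This makes the exposure vertex by vertex free of conditioning.
\<close>

lemma random_hypergraph_Suc: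
  "random_hypergraph (Suc t) (Suc l) p = map_pmf (\<lambda>(H, A). H \<union> insert t ` A)
     (pair_pmf (random_hypergraph t (Suc l) p) (random_hypergraph t l p))"
proof -
  have inj: "inj_on (insert t) (k_subsets t l)"
  proof (rule inj_onI)
    fix x y assume "x \<in> k_subsets t l" "y \<in> k_subsets t l" "insert t x = insert t y"
    moreover from this have "t \<notin> x" "t \<notin> y" by (auto simp: k_subsets_def)
    ultimately show "x = y" by (simp add: insert_ident)
  qed
  have "k_subsets t (Suc l) \<inter> insert t ` k_subsets t l = {}" by (auto simp: k_subsets_def)
  thus ?thesis
    by (simp add: random_hypergraph_eq k_subsets_Suc_Suc random_subset_union random_subset_image inj
      pair_map_pmf2 map_pmf_comp case_prod_unfold)
qed

lemma random_hypergraph_pair_Suc: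
  "random_hypergraph_pair (Suc t) (Suc l) p q =
     map_pmf (\<lambda>((H1, H2), (A, B)). (H1 \<union> insert t ` A, H2 \<union> insert t ` B))
     (pair_pmf (random_hypergraph_pair t (Suc l) p q) (random_hypergraph_pair t l p q))"
  unfolding random_hypergraph_pair_def random_hypergraph_Suc
  by (simp add: pair_pmf_def map_pmf_def bind_assoc_pmf bind_return_pmf
      bind_commute_pmf[of "random_hypergraph t l p" "random_hypergraph t (Suc l) q"])

text \<open>
  The packing \<open>\<phi>\<close> is extended by composing it with the transposition of \<open>u\<close> and \<open>t\<close>. Edges that contain neither
  are handled by \<open>\<phi>\<close>; an edge through exactly one of them is compared with a set that is old on one
  side and new on the other, and an edge through both with a pair of new sets.
  The last three hypotheses correspond to these cases.
\<close>

lemma swap_packing: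
  assumes bij: "bij_betw \<phi> {..<t} {..<t}" and u: "u < t"
    and H: "H1 \<subseteq> k_subsets t (Suc l)" "H2 \<subseteq> k_subsets t (Suc l)"
    and AB: "A \<subseteq> k_subsets t l" "B \<subseteq> k_subsets t l"
    and packed: "\<And>e. e \<in> H1 \<Longrightarrow> \<phi> ` e \<notin> H2"
    and new1: "\<And>z. z \<in> A \<Longrightarrow> u \<notin> z \<Longrightarrow> insert (\<phi> u) (\<phi> ` z) \<notin> H2"
    and new2: "\<And>e. e \<in> H1 \<Longrightarrow> u \<in> e \<Longrightarrow> \<phi> ` (e - {u}) \<notin> B"
    and new12: "\<And>z. z \<in> A \<Longrightarrow> u \<in> z \<Longrightarrow> \<phi> ` z \<notin> B"
  shows "packable {..<Suc t} (H1 \<union> insert t ` A) {..<Suc t} (H2 \<union> insert t ` B)"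
proof -
  define \<psi> where "\<psi> = \<phi>(u := t, t := \<phi> u)"
  have inj: "inj_on \<phi> {..<t}" and im: "\<phi> ` {..<t} = {..<t}" using bij by (auto simp: bij_betw_def)
  have lt: "\<phi> v < t" if "v < t" for v using im that by auto
  have "\<psi> ` {..<Suc t} \<subseteq> {..<Suc t}" using lt u by (auto simp: \<psi>_def less_Suc_eq)
  moreover have "inj_on \<psi> {..<Suc t}"
  proof (rule inj_onI)
    fix v w assume "v \<in> {..<Suc t}" "w \<in> {..<Suc t}" "\<psi> v = \<psi> w"
    thus "v = w" using inj_onD[OF inj, of v w] inj_onD[OF inj, of u w] inj_onD[OF inj, of v u]
        lt[of v] lt[of w] lt[of u] u
      by (auto simp: \<psi>_def less_Suc_eq split: if_splits)
  qed
  ultimately have "bij_betw \<psi> {..<Suc t} {..<Suc t}"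
    by (simp add: bij_betw_def endo_inj_surj)
  moreover have "\<psi> ` e \<notin> H2 \<union> insert t ` B" if e: "e \<in> H1 \<union> insert t ` A" for e
  proof -
    have tB: "t \<notin> y" if "y \<in> B" for y using that AB by (auto simp: k_subsets_def)
    have tH2: "t \<notin> y" if "y \<in> H2" for y using that H by (auto simp: k_subsets_def)
    have \<phi>_im: "t \<notin> \<phi> ` x" if "x \<subseteq> {..<t}" for x using that im by auto
    have insert_t: "insert t x \<noteq> insert t y" if "t \<notin> x" "y \<in> B" "x \<notin> B" for x y
      using that tB by (metis insert_ident)
    have \<psi>_im: "\<psi> ` x = \<phi> ` x" if "x \<subseteq> {..<t}" "u \<notin> x" for x
    proof (rule image_cong[OF refl])
      fix v assume "v \<in> x"
      hence "v \<noteq> t" "v \<noteq> u" using that by auto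
      thus "\<psi> v = \<phi> v" by (simp add: \<psi>_def)
    qed
    have \<psi>_u: "\<psi> ` x = insert t (\<phi> ` (x - {u}))" if "x \<subseteq> {..<t}" "u \<in> x" for x
    proof -
      have "\<psi> ` x = insert (\<psi> u) (\<psi> ` (x - {u}))" using that by blast
      thus ?thesis using \<psi>_im[of "x - {u}"] that u by (auto simp: \<psi>_def)
    qed
    consider "e \<in> H1" | z where "z \<in> A" "e = insert t z" using e by blast
    thus ?thesis
    proof cases
      case 1
      hence e: "e \<subseteq> {..<t}" using H by (auto simp: k_subsets_def)
      show ?thesis
      proof (cases "u \<in> e")
        case True
        have "t \<notin> \<phi> ` (e - {u})" by (rule \<phi>_im) (use e in auto)
        thus ?thesis using \<psi>_u[OF e True] new2[OF 1 True] tB tH2 insert_t by auto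
      next
        case False
        thus ?thesis using \<psi>_im[OF e False] packed[OF 1] \<phi>_im[OF e] by (auto)
      qed
    next
      case 2
      hence z: "z \<subseteq> {..<t}" using AB by (auto simp: k_subsets_def)
      have "\<psi> ` e = insert (\<psi> t) (\<psi> ` z)" using 2 by simp
      hence e: "\<psi> ` e = insert (\<phi> u) (\<psi> ` z)" by (simp add: \<psi>_def)
      show ?thesis
      proof (cases "u \<in> z")
        case True
        have "\<psi> ` e = insert t (\<phi> ` z)" using e \<psi>_u[OF z True] True by auto
        thus ?thesis using new12[OF 2(1) True] tB tH2 \<phi>_im[OF z] insert_t by auto
      next
        case False
        have "\<psi> ` e = insert (\<phi> u) (\<phi> ` z)" using e \<psi>_im[OF z False] by simp
        moreover have "t \<notin> insert (\<phi> u) (\<phi> ` z)" using \<phi>_im[OF z] lt[OF u] by auto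
        ultimately show ?thesis using new1[OF 2(1) False] by auto
      qed
    qed
  qed
  ultimately show ?thesis unfolding packable_def by blast
qed

text \<open>
  The degrees of single vertices bound the sizes of the obstacle sets below, and the degrees of \<open>l\<close>-sets bound
  the number of vertices that have a given obstacle.
\<close>

definition bounded_degrees :: "nat \<Rightarrow> nat \<Rightarrow> nat \<Rightarrow> nat \<Rightarrow> nat set set \<Rightarrow> bool" where
  "bounded_degrees t l d D H \<longleftrightarrow>
     (\<forall>u<t. card {e \<in> H. u \<in> e} \<le> d) \<and>
     (\<forall>z\<in>k_subsets t l. card {w. w < t \<and> w \<notin> z \<and> insert w z \<in> H} \<le> D)"

lemma unbounded_degrees_prob:
  assumes p: "0 \<le> p" "p \<le> 1"
  shows "measure_pmf.prob (random_hypergraph t (Suc l) p) {H. \<not> bounded_degrees t l d D H}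
    \<le> t * (exp (p * t ^ l) / 2 ^ Suc d) + t ^ l * (exp (p * t) / 2 ^ Suc D)"
proof -
  let ?M = "random_hypergraph t (Suc l) p"
  let ?E = "\<lambda>u. {H. Suc d \<le> card (H \<inter> {e. u \<in> e})}"
  let ?F = "\<lambda>z. {H. Suc D \<le> card (H \<inter> (\<lambda>w. insert w z) ` ({..<t} - z))}"
  have "measure_pmf.prob ?M {H. \<not> bounded_degrees t l d D H}
     \<le> measure_pmf.prob ?M ((\<Union>u\<in>{..<t}. ?E u) \<union> (\<Union>z\<in>k_subsets t l. ?F z))"
  proof (rule measure_pmf.finite_measure_mono; (intro subsetI)?)
    fix H assume "H \<in> {H. \<not> bounded_degrees t l d D H}"
    then consider u where "u < t" "card {e \<in> H. u \<in> e} > d"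
      | z where "z \<in> k_subsets t l" "card {w. w < t \<and> w \<notin> z \<and> insert w z \<in> H} > D"
      by (auto simp: bounded_degrees_def not_le)
    thus "H \<in> (\<Union>u\<in>{..<t}. ?E u) \<union> (\<Union>z\<in>k_subsets t l. ?F z)"
    proof cases
      case 1
      hence "H \<in> ?E u" by (simp add: Int_def Suc_le_eq)
      thus ?thesis using 1 by blast
    next
      case 2
      have "inj_on (\<lambda>w. insert w z) ({..<t} - z)" by (auto simp: inj_on_def)
      hence "card {w. w < t \<and> w \<notin> z \<and> insert w z \<in> H} = card ((\<lambda>w. insert w z) ` {w. w < t \<and> w \<notin> z \<and> insert w z \<in> H})"
        by (intro card_image[symmetric]) (auto simp: inj_on_def)
      also have "(\<lambda>w. insert w z) ` {w. w < t \<and> w \<notin> z \<and> insert w z \<in> H} = H \<inter> (\<lambda>w. insert w z) ` ({..<t} - z)"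
        by auto
      finally have "H \<in> ?F z" using 2 by simp
      thus ?thesis using 2 by blast
    qed
  qed auto
  also have "\<dots> \<le> measure_pmf.prob ?M (\<Union>u\<in>{..<t}. ?E u) + measure_pmf.prob ?M (\<Union>z\<in>k_subsets t l. ?F z)"
    by (rule measure_Un_le) auto
  also have "measure_pmf.prob ?M (\<Union>u\<in>{..<t}. ?E u) \<le> (\<Sum>u\<in>{..<t}. measure_pmf.prob ?M (?E u))"
    by (rule measure_UNION_le) auto
  also have "\<dots> \<le> (\<Sum>u\<in>{..<t}. exp (p * t ^ l) / 2 ^ Suc d)"
  proof (rule sum_mono)
    fix u assume u: "u \<in> {..<t}"
    have "card (k_subsets t (Suc l) \<inter> {e. u \<in> e}) \<le> card (k_subsets t l)"
    proof (rule card_inj_on_le[of "\<lambda>e. e - {u}"])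
      show "inj_on (\<lambda>e. e - {u}) (k_subsets t (Suc l) \<inter> {e. u \<in> e})"
        by (auto simp: inj_on_def)
      show "(\<lambda>e. e - {u}) ` (k_subsets t (Suc l) \<inter> {e. u \<in> e}) \<subseteq> k_subsets t l"
        by (auto simp: k_subsets_def) 
    qed auto
    hence "card (k_subsets t (Suc l) \<inter> {e. u \<in> e}) \<le> t ^ l"
      using card_k_subsets_le[of t l] by linarith
    from random_subset_tail[OF finite_k_subsets p this, of "Suc d"]
    show "measure_pmf.prob ?M (?E u) \<le> exp (p * t ^ l) / 2 ^ Suc d"
      by (simp add: random_hypergraph_eq)
  qed
  also have "(\<Sum>u\<in>{..<t}. exp (p * t ^ l) / 2 ^ Suc d) = t * (exp (p * t ^ l) / 2 ^ Suc d)" by simp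
  also have "measure_pmf.prob ?M (\<Union>z\<in>k_subsets t l. ?F z) \<le> (\<Sum>z\<in>k_subsets t l. measure_pmf.prob ?M (?F z))"
    by (rule measure_UNION_le) auto
  also have "\<dots> \<le> (\<Sum>z\<in>k_subsets t l. exp (p * t) / 2 ^ Suc D)"
  proof (rule sum_mono)
    fix z assume z: "z \<in> k_subsets t l"
    have "card (k_subsets t (Suc l) \<inter> (\<lambda>w. insert w z) ` ({..<t} - z)) \<le> card ((\<lambda>w. insert w z) ` ({..<t} - z))"
      by (rule card_mono) auto
    also have "\<dots> \<le> card ({..<t} - z)" by (rule card_image_le) auto
    also have "\<dots> \<le> card {..<t}" by (rule card_mono) auto
    finally have "card (k_subsets t (Suc l) \<inter> (\<lambda>w. insert w z) ` ({..<t} - z)) \<le> t" by simp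
    from random_subset_tail[OF finite_k_subsets p this, of "Suc D"]
    show "measure_pmf.prob ?M (?F z) \<le> exp (p * t) / 2 ^ Suc D"
      by (simp add: random_hypergraph_eq)
  qed
  also have "\<dots> \<le> t ^ l * (exp (p * t) / 2 ^ Suc D)"
    using card_k_subsets_le[of t l] by (simp add: divide_right_mono mult_right_mono del: of_nat_power add: of_nat_power[symmetric])
  finally show ?thesis by simp
qed

section \<open>Extending a packing by a transposition\<close>

text \<open>
  The two fresh random hypergraphs are treated as one random subset of a disjoint sum; \<open>Inl\<close> carries
  the first and \<open>Inr\<close> the second. The obstacles of \<open>u\<close> are the coordinates whose presence would create
  a conflict with an old edge when \<open>u\<close> is swapped with the new vertex.
\<close>

definition obstacles :: "nat \<Rightarrow> nat \<Rightarrow> (nat \<Rightarrow> nat) \<Rightarrow> nat set set \<Rightarrow> nat set set \<Rightarrow> nat \<Rightarrow> (nat set + nat set) set" where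
  "obstacles t l \<phi> H1 H2 u =
     Inl ` {z \<in> k_subsets t l. u \<notin> z \<and> insert (\<phi> u) (\<phi> ` z) \<in> H2} \<union>
     Inr ` {\<phi> ` (e - {u}) |e. e \<in> H1 \<and> u \<in> e}"

lemma card_obstacles_le:
  assumes bij: "bij_betw \<phi> {..<t} {..<t}" and u: "u < t"
    and H: "H1 \<subseteq> k_subsets t (Suc l)" "H2 \<subseteq> k_subsets t (Suc l)"
    and deg: "bounded_degrees t l d D H1" "bounded_degrees t l d D H2"
  shows "card (obstacles t l \<phi> H1 H2 u) \<le> 2 * d"
proof -
  have inj: "inj_on \<phi> {..<t}" and im: "\<phi> ` {..<t} = {..<t}" using bij by (auto simp: bij_betw_def)
  have fin: "finite H1" "finite H2" using H finite_subset finite_k_subsets by metis+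
  have "card {z \<in> k_subsets t l. u \<notin> z \<and> insert (\<phi> u) (\<phi> ` z) \<in> H2} \<le> card {e \<in> H2. \<phi> u \<in> e}"
  proof (rule card_inj_on_le[of "\<lambda>z. insert (\<phi> u) (\<phi> ` z)"])
    show "inj_on (\<lambda>z. insert (\<phi> u) (\<phi> ` z)) {z \<in> k_subsets t l. u \<notin> z \<and> insert (\<phi> u) (\<phi> ` z) \<in> H2}"
    proof (rule inj_onI)
      fix x y
      assume x: "x \<in> {z \<in> k_subsets t l. u \<notin> z \<and> insert (\<phi> u) (\<phi> ` z) \<in> H2}"
        and y: "y \<in> {z \<in> k_subsets t l. u \<notin> z \<and> insert (\<phi> u) (\<phi> ` z) \<in> H2}"
        and eq: "insert (\<phi> u) (\<phi> ` x) = insert (\<phi> u) (\<phi> ` y)"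
      have sub: "insert u x \<subseteq> {..<t}" "insert u y \<subseteq> {..<t}" using x y u by (auto simp: k_subsets_def)
      have "\<phi> ` insert u x = \<phi> ` insert u y" using eq by simp
      hence "insert u x = insert u y" using inj_on_image_eq_iff[OF inj sub] by blast
      thus "x = y" using x y by (simp add: insert_ident)
    qed
  qed (use fin in auto)
  also have "\<dots> \<le> d" using deg(2) u im by (auto simp: bounded_degrees_def)
  finally have 1: "card (Inl ` {z \<in> k_subsets t l. u \<notin> z \<and> insert (\<phi> u) (\<phi> ` z) \<in> H2} :: (nat set + nat set) set) \<le> d"
    by (simp add: card_image)
  have "card {\<phi> ` (e - {u}) |e. e \<in> H1 \<and> u \<in> e} = card ((\<lambda>e. \<phi> ` (e - {u})) ` {e \<in> H1. u \<in> e})"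
    by (rule arg_cong[where f = card]) auto
  also have "\<dots> \<le> card {e \<in> H1. u \<in> e}" by (rule card_image_le) (use fin in auto)
  also have "\<dots> \<le> d" using deg(1) u by (auto simp: bounded_degrees_def)
  finally have 2: "card (Inr ` {\<phi> ` (e - {u}) |e. e \<in> H1 \<and> u \<in> e} :: (nat set + nat set) set) \<le> d"
    by (simp add: card_image)
  show ?thesis using card_Un_le[of "Inl ` {z \<in> k_subsets t l. u \<notin> z \<and> insert (\<phi> u) (\<phi> ` z) \<in> H2}"
      "Inr ` {\<phi> ` (e - {u}) |e. e \<in> H1 \<and> u \<in> e}"] 1 2
    unfolding obstacles_def by linarith
qed

lemma card_obstructed_le:
  assumes bij: "bij_betw \<phi> {..<t} {..<t}"
    and H: "H1 \<subseteq> k_subsets t (Suc l)" "H2 \<subseteq> k_subsets t (Suc l)"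
    and deg: "bounded_degrees t l d D H1" "bounded_degrees t l d D H2"
    and s: "s \<in> Inl ` k_subsets t l \<union> Inr ` k_subsets t l"
  shows "card {u. u < t \<and> s \<in> obstacles t l \<phi> H1 H2 u} \<le> D"
proof -
  have inj: "inj_on \<phi> {..<t}" and im: "\<phi> ` {..<t} = {..<t}" using bij by (auto simp: bij_betw_def)
  have im': "\<exists>z\<in>k_subsets t l. y = \<phi> ` z" if "y \<in> k_subsets t l" for y
  proof -
    have "y \<in> image \<phi> ` k_subsets t l"
      using image_k_subsets[OF bij, of l] that by (simp add: bij_betw_def)
    thus ?thesis by blast
  qed
  have im'': "\<phi> ` z \<in> k_subsets t l" if "z \<in> k_subsets t l" for z
    using image_k_subsets[OF bij, of l] that by (auto simp: bij_betw_def)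
  from s consider z where "z \<in> k_subsets t l" "s = Inl z" | y where "y \<in> k_subsets t l" "s = Inr y" by blast
  thus ?thesis
  proof cases
    case 1
    hence z: "z \<subseteq> {..<t}" by (auto simp: k_subsets_def)
    have "card {u. u < t \<and> s \<in> obstacles t l \<phi> H1 H2 u}
       \<le> card {w. w < t \<and> w \<notin> \<phi> ` z \<and> insert w (\<phi> ` z) \<in> H2}"
    proof (rule card_inj_on_le[of \<phi>])
      show "inj_on \<phi> {u. u < t \<and> s \<in> obstacles t l \<phi> H1 H2 u}"
        by (rule inj_on_subset[OF inj]) auto
      show "\<phi> ` {u. u < t \<and> s \<in> obstacles t l \<phi> H1 H2 u} \<subseteq> {w. w < t \<and> w \<notin> \<phi> ` z \<and> insert w (\<phi> ` z) \<in> H2}"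
      proof (rule image_subsetI)
        fix u assume "u \<in> {u. u < t \<and> s \<in> obstacles t l \<phi> H1 H2 u}"
        hence u: "u < t" "u \<notin> z" "insert (\<phi> u) (\<phi> ` z) \<in> H2" using 1 by (auto simp: obstacles_def)
        have "\<phi> u \<notin> \<phi> ` z" using inj_on_image_mem_iff[OF inj, of u z] u z by auto
        thus "\<phi> u \<in> {w. w < t \<and> w \<notin> \<phi> ` z \<and> insert w (\<phi> ` z) \<in> H2}" using u im by auto
      qed
    qed auto
    also have "\<dots> \<le> D" using deg(2) im''[OF 1(1)] by (auto simp: bounded_degrees_def)
    finally show ?thesis .
  next
    case 2
    obtain z where z: "z \<in> k_subsets t l" "y = \<phi> ` z" using im'[OF 2(1)] by blast
    hence zt: "z \<subseteq> {..<t}" by (auto simp: k_subsets_def)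
    have "card {u. u < t \<and> s \<in> obstacles t l \<phi> H1 H2 u}
       \<le> card {w. w < t \<and> w \<notin> z \<and> insert w z \<in> H1}"
    proof (rule card_mono)
      show "{u. u < t \<and> s \<in> obstacles t l \<phi> H1 H2 u} \<subseteq> {w. w < t \<and> w \<notin> z \<and> insert w z \<in> H1}"
      proof
        fix u assume "u \<in> {u. u < t \<and> s \<in> obstacles t l \<phi> H1 H2 u}"
        then obtain e where e: "u < t" "e \<in> H1" "u \<in> e" "\<phi> ` z = \<phi> ` (e - {u})"
          using 2 z by (auto simp: obstacles_def)
        have "e - {u} \<subseteq> {..<t}" using e(2) H by (auto simp: k_subsets_def)
        hence "z = e - {u}" using inj_on_image_eq_iff[OF inj zt] e(4) by blast
        thus "u \<in> {w. w < t \<and> w \<notin> z \<and> insert w z \<in> H1}" using e by (simp add: insert_absorb)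
      qed
    qed auto
    also have "\<dots> \<le> D" using deg(1) z(1) by (auto simp: bounded_degrees_def)
    finally show ?thesis .
  qed
qed

lemma random_subset_Plus:
  assumes "finite S" "finite T"
  shows "random_subset (Inl ` S \<union> Inr ` T) p =
     map_pmf (\<lambda>(A, B). Inl ` A \<union> Inr ` B) (pair_pmf (random_subset S p) (random_subset T p))"
proof -
  have "Inl ` S \<inter> Inr ` T = {}" by auto
  thus ?thesis using assms
    by (simp add: random_subset_union random_subset_image inj_on_def pair_map_pmf1 pair_map_pmf2
        map_pmf_comp case_prod_unfold)
qed

lemma random_subset_pair_image:
  assumes "finite S" "bij_betw g S S"
  shows "measure_pmf.prob (pair_pmf (random_subset S p) (random_subset S q)) {(A, B). P (g ` A) B}
       = measure_pmf.prob (pair_pmf (random_subset S p) (random_subset S q)) {(A, B). P A B}"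
proof -
  let ?M = "pair_pmf (random_subset S p) (random_subset S q)"
  have "random_subset S p = map_pmf (image g) (random_subset S p)"
    using random_subset_image[of S g p] assms by (simp add: bij_betw_def)
  hence "?M = map_pmf (apfst (image g)) ?M"
    by (subst pair_map_pmf1[symmetric]) simp
  hence "measure_pmf.prob ?M {(A, B). P A B} = measure_pmf.prob (map_pmf (apfst (image g)) ?M) {(A, B). P A B}"
    by simp
  also have "\<dots> = measure_pmf.prob ?M {(A, B). P (g ` A) B}"
    unfolding measure_map_pmf by (rule arg_cong[where f = "measure_pmf.prob ?M"]) auto
  finally show ?thesis by simp
qed

text \<open>
  A conflict between two new edges needs a \<open>z \<in> A\<close> that is mapped into \<open>B\<close>. Fewer than \<open>j\<close> such sets
  cover fewer than \<open>r\<close> vertices, so one of \<open>r\<close> distinct candidates is left. The residue classes modulo \<open>r\<close>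
  serve only to have \<open>r\<close> disjoint pools of candidates.
\<close>

lemma swappable_vertex:
  assumes r: "r = Suc l * j" "0 < r"
    and AB: "A \<subseteq> k_subsets t l"
    and bij: "bij_betw \<phi> {..<t} {..<t}"
    and few: "card (image \<phi> ` A \<inter> B) < j"
    and unhit: "\<And>i. i < r \<Longrightarrow> \<exists>u. u < t \<and> u mod r = i \<and> P u"
  shows "\<exists>u<t. P u \<and> (\<forall>z\<in>A. u \<in> z \<longrightarrow> \<phi> ` z \<notin> B)"
proof -
  have inj: "inj_on (image \<phi>) A"
    using image_k_subsets[OF bij, of l] AB by (auto simp: bij_betw_def intro: inj_on_subset)
  define Z where "Z = {z \<in> A. \<phi> ` z \<in> B}"
  have finA: "finite A" using AB finite_k_subsets finite_subset by blast
  have "card Z = card (image \<phi> ` Z)" by (rule card_image[symmetric]) (rule inj_on_subset[OF inj], auto simp: Z_def)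
  also have "\<dots> \<le> card (image \<phi> ` A \<inter> B)" by (rule card_mono) (use finA in \<open>auto simp: Z_def\<close>)
  finally have Z: "card Z < j" using few by simp
  have finZ: "finite Z" using finA by (simp add: Z_def)
  have "card (\<Union>Z) \<le> (\<Sum>z\<in>Z. card z)"
    by (rule card_Union_le_sum_card)
  also have "\<dots> = (\<Sum>z\<in>Z. l)" by (rule sum.cong) (use AB in \<open>auto simp: Z_def k_subsets_def\<close>)
  also have "\<dots> \<le> j * l" using Z by simp
  also have "\<dots> < r" using r Z by simp
  finally have small: "card (\<Union>Z) < r" .
  have finU: "finite (\<Union>Z)"
    by (rule finite_subset[of _ "{..<t}"]) (use AB in \<open>auto simp: Z_def k_subsets_def\<close>)
  from unhit obtain f where f: "\<And>i. i < r \<Longrightarrow> f i < t \<and> f i mod r = i \<and> P (f i)" by metis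
  have "inj_on f {..<r}" by (rule inj_on_inverseI[of _ "\<lambda>u. u mod r"]) (use f in auto)
  hence "card (f ` {..<r}) = r" by (simp add: card_image)
  hence "\<not> f ` {..<r} \<subseteq> \<Union>Z" using small card_mono[OF finU, of "f ` {..<r}"] by linarith
  then obtain i where i: "i < r" "f i \<notin> \<Union>Z" by blast
  hence "\<phi> ` z \<notin> B" if "z \<in> A" "f i \<in> z" for z using that by (auto simp: Z_def)
  thus ?thesis using f[OF i(1)] by blast
qed

lemma card_residue_class_ge: "0 < r \<Longrightarrow> i < r \<Longrightarrow> t div r \<le> card {u. u < t \<and> u mod r = i}" for t :: nat
proof -
  assume r: "0 < r" "i < r"
  have "card {..<t div r} \<le> card {u. u < t \<and> u mod r = i}"
  proof (rule card_inj_on_le[of "\<lambda>a. a * r + i"])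
    show "inj_on (\<lambda>a. a * r + i) {..<t div r}" using r by (auto simp: inj_on_def)
    show "(\<lambda>a. a * r + i) ` {..<t div r} \<subseteq> {u. u < t \<and> u mod r = i}"
    proof (rule image_subsetI)
      fix a assume "a \<in> {..<t div r}"
      hence "Suc a * r \<le> (t div r) * r" by (intro mult_le_mono1) auto
      also have "\<dots> \<le> t" by simp
      finally show "a * r + i \<in> {u. u < t \<and> u mod r = i}" using r by simp
    qed
  qed auto
  thus ?thesis by simp
qed

text \<open>
  The first summand bounds the probability that in some residue class every vertex meets an obstacle, the second
  one the probability that at least \<open>j\<close> sets of \<open>A\<close> are mapped into \<open>B\<close>.
\<close>

lemma extension_failure_prob:
  assumes p: "0 \<le> p" "p \<le> 1"
    and H: "H1 \<subseteq> k_subsets t (Suc l)" "H2 \<subseteq> k_subsets t (Suc l)"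
    and deg: "bounded_degrees t l d D H1" "bounded_degrees t l d D H2"
    and pack: "packable {..<t} H1 {..<t} H2"
    and r: "r = Suc l * j" "0 < r" "h * D < t div r"
  shows "measure_pmf.prob (random_hypergraph_pair t l p p)
       {(A, B). \<not> packable {..<Suc t} (H1 \<union> insert t ` A) {..<Suc t} (H2 \<union> insert t ` B)}
     \<le> r * ((1 - (1 - p) ^ (2 * d)) ^ m + ((1 + p) ^ (2 * d)) ^ m / 2 ^ h) + exp (p * p * t ^ l) / 2 ^ j"
proof -
  define Z where "Z = k_subsets t l"
  have finZ: "finite Z" by (simp add: Z_def)
  let ?M = "random_hypergraph_pair t l p p"
  have M: "?M = pair_pmf (random_subset Z p) (random_subset Z p)"
    by (simp add: random_hypergraph_pair_def random_hypergraph_eq Z_def)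
  obtain \<phi> where bij: "bij_betw \<phi> {..<t} {..<t}" and \<phi>: "\<And>e. e \<in> H1 \<Longrightarrow> \<phi> ` e \<notin> H2"
    using pack by (auto simp: packable_def)
  define T where "T = obstacles t l \<phi> H1 H2"
  define U where "U i = {u. u < t \<and> u mod r = i}" for i
  let ?hit = "\<lambda>i. {(A, B). \<forall>u\<in>U i. (Inl ` A \<union> Inr ` B) \<inter> T u \<noteq> {}}"
  let ?many = "{(A, B). j \<le> card (image \<phi> ` A \<inter> B)}"
  have "measure_pmf.prob ?M {(A, B). \<not> packable {..<Suc t} (H1 \<union> insert t ` A) {..<Suc t} (H2 \<union> insert t ` B)}
      \<le> measure_pmf.prob ?M ((\<Union>i\<in>{..<r}. ?hit i) \<union> ?many)"
  proof (rule measure_pmf.finite_measure_mono_AE)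
    show "AE x in ?M. x \<in> {(A, B). \<not> packable {..<Suc t} (H1 \<union> insert t ` A) {..<Suc t} (H2 \<union> insert t ` B)}
       \<longrightarrow> x \<in> (\<Union>i\<in>{..<r}. ?hit i) \<union> ?many"
    proof (intro AE_pmfI impI, rule ccontr)
      fix x assume x: "x \<in> set_pmf ?M"
        "x \<in> {(A, B). \<not> packable {..<Suc t} (H1 \<union> insert t ` A) {..<Suc t} (H2 \<union> insert t ` B)}"
        "x \<notin> (\<Union>i\<in>{..<r}. ?hit i) \<union> ?many"
      obtain A B where [simp]: "x = (A, B)" by (cases x)
      have AB: "A \<subseteq> Z" "B \<subseteq> Z" using x(1) unfolding M using set_random_subset[of Z p] by auto
      have np: "\<not> packable {..<Suc t} (H1 \<union> insert t ` A) {..<Suc t} (H2 \<union> insert t ` B)"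
        using x(2) by simp
      have nin: "(A, B) \<notin> (\<Union>i\<in>{..<r}. ?hit i) \<union> ?many" using x(3) by simp
      from nin have few: "card (image \<phi> ` A \<inter> B) < j"
        and unhit: "\<And>i. i < r \<Longrightarrow> (A, B) \<notin> ?hit i" by (simp_all add: not_le)
      have "\<exists>u. u < t \<and> u mod r = i \<and> (Inl ` A \<union> Inr ` B) \<inter> T u = {}" if "i < r" for i
        using unhit[OF that] unfolding U_def by blast
      hence "\<exists>u<t. (Inl ` A \<union> Inr ` B) \<inter> T u = {} \<and> (\<forall>z\<in>A. u \<in> z \<longrightarrow> \<phi> ` z \<notin> B)"
        by (rule swappable_vertex[OF r(1,2) AB(1)[unfolded Z_def] bij few])
      then obtain u where u: "u < t" "(Inl ` A \<union> Inr ` B) \<inter> T u = {}"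
        and new: "\<forall>z\<in>A. u \<in> z \<longrightarrow> \<phi> ` z \<notin> B"
        by (elim exE conjE) (rule that)
      have "packable {..<Suc t} (H1 \<union> insert t ` A) {..<Suc t} (H2 \<union> insert t ` B)"
      proof (rule swap_packing[OF bij u(1) H AB[unfolded Z_def] \<phi> _ _ new[rule_format]])
        fix z assume z: "z \<in> A" "u \<notin> z"
        show "insert (\<phi> u) (\<phi> ` z) \<notin> H2"
        proof
          assume "insert (\<phi> u) (\<phi> ` z) \<in> H2"
          hence "Inl z \<in> T u" using z AB by (auto simp: T_def obstacles_def Z_def)
          thus False using u(2) z by blast
        qed
      next
        fix e assume e: "e \<in> H1" "u \<in> e"
        hence "Inr (\<phi> ` (e - {u})) \<in> T u" by (auto simp: T_def obstacles_def)
        thus "\<phi> ` (e - {u}) \<notin> B" using u(2) by blast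
      qed
      with np show False by (rule notE)
    qed
  qed auto
  also have "\<dots> \<le> measure_pmf.prob ?M (\<Union>i\<in>{..<r}. ?hit i) + measure_pmf.prob ?M ?many"
    by (rule measure_Un_le) auto
  also have "measure_pmf.prob ?M (\<Union>i\<in>{..<r}. ?hit i) \<le> (\<Sum>i<r. measure_pmf.prob ?M (?hit i))"
    by (rule measure_UNION_le) auto
  also have "\<dots> \<le> (\<Sum>i<r. (1 - (1 - p) ^ (2 * d)) ^ m + ((1 + p) ^ (2 * d)) ^ m / 2 ^ h)"
  proof (rule sum_mono)
    fix i assume i: "i \<in> {..<r}"
    have finT: "finite (T u)" if "u < t" for u
    proof -
      have "finite H1" using H finite_subset finite_k_subsets by metis
      thus ?thesis by (auto simp: T_def obstacles_def)
    qed
    have "measure_pmf.prob ?M (?hit i)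
       = measure_pmf.prob (random_subset (Inl ` Z \<union> Inr ` Z) p) {X. \<forall>u\<in>U i. X \<inter> T u \<noteq> {}}"
      by (simp add: M random_subset_Plus finZ vimage_def case_prod_unfold)
    also have "\<dots> \<le> (1 - (1 - p) ^ (2 * d)) ^ m + ((1 + p) ^ (2 * d)) ^ m / 2 ^ h"
    proof (rule random_subset_hits_all[OF _ _ p])
      fix u assume u: "u \<in> U i"
      have "card ((Inl ` Z \<union> Inr ` Z) \<inter> T u) \<le> card (T u)"
        by (rule card_mono) (use finT u in \<open>auto simp: U_def\<close>)
      also have "\<dots> \<le> 2 * d"
        unfolding T_def by (rule card_obstacles_le[OF bij _ H deg]) (use u in \<open>simp add: U_def\<close>)
      finally show "card ((Inl ` Z \<union> Inr ` Z) \<inter> T u) \<le> 2 * d" .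
    next
      fix s assume s: "s \<in> Inl ` Z \<union> Inr ` Z"
      have "card {u \<in> U i. s \<in> T u} \<le> card {u. u < t \<and> s \<in> T u}"
        by (rule card_mono) (auto simp: U_def)
      also have "\<dots> \<le> D" unfolding T_def
        by (rule card_obstructed_le[OF bij H deg s[unfolded Z_def]])
      finally show "card {u \<in> U i. s \<in> T u} \<le> D" .
    next
      show "h * D < card (U i)" using r(3) card_residue_class_ge[OF r(2), of i t] i by (simp add: U_def)
    qed (auto simp: finZ U_def)
    finally show "measure_pmf.prob ?M (?hit i) \<le> \<dots>" .
  qed
  also have "\<dots> = r * ((1 - (1 - p) ^ (2 * d)) ^ m + ((1 + p) ^ (2 * d)) ^ m / 2 ^ h)" by simp
  also have "measure_pmf.prob ?M ?many \<le> exp (p * p * t ^ l) / 2 ^ j"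
  proof -
    have bijZ: "bij_betw (image \<phi>) Z Z" unfolding Z_def by (rule image_k_subsets[OF bij])
    have "measure_pmf.prob ?M ?many = measure_pmf.prob ?M {(A, B). j \<le> card (A \<inter> B)}"
      unfolding M by (rule random_subset_pair_image[OF finZ bijZ])
    moreover have "card Z \<le> t ^ l" unfolding Z_def by (rule card_k_subsets_le)
    note random_subset_pair_tail[OF finZ p p this, of j]
    ultimately show ?thesis unfolding M by simp
  qed
  finally show ?thesis by simp
qed

definition unpackable_prob :: "nat \<Rightarrow> nat \<Rightarrow> real \<Rightarrow> real" where
  "unpackable_prob n k p = measure_pmf.prob (random_hypergraph_pair n k p p)
     {(G1, G2). \<not> packable {..<n} G1 {..<n} G2}"

text \<open>
  The identity is a packing unless some edge lies in both hypergraphs.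
\<close>

lemma unpackable_prob_le:
  assumes p: "0 \<le> p" "p \<le> 1"
  shows "unpackable_prob t k p \<le> t ^ k * p\<^sup>2"
proof -
  let ?M = "random_hypergraph_pair t k p p"
  have "packable {..<t} G1 {..<t} G2" if "G1 \<inter> G2 = {}" for G1 G2 :: "nat set set"
    unfolding packable_def by (rule exI[of _ id]) (use that in auto)
  hence "unpackable_prob t k p \<le> measure_pmf.prob ?M (UNIV - {(G1, G2). G1 \<inter> G2 = {}})"
    unfolding unpackable_prob_def by (intro measure_pmf.finite_measure_mono) auto
  also have "\<dots> = 1 - measure_pmf.prob ?M {(G1, G2). G1 \<inter> G2 = {}}"
    using measure_pmf.prob_compl[of "{(G1, G2). G1 \<inter> G2 = {}}" ?M] by simp
  also have "measure_pmf.prob ?M {(G1, G2). G1 \<inter> G2 = {}} = (1 - p * p) ^ card (k_subsets t k)"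
    using random_subset_pair_disjoint_prob[OF finite_k_subsets p p, of t k]
    by (simp add: random_hypergraph_pair_def random_hypergraph_eq)
  also have "1 - (1 - p * p) ^ card (k_subsets t k) \<le> card (k_subsets t k) * (p * p)"
    using Bernoulli_inequality[of "- (p * p)" "card (k_subsets t k)"] p mult_le_one[of p p] by simp
  also have "\<dots> \<le> real (t ^ k) * (p * p)"
    by (intro mult_right_mono) (use card_k_subsets_le[of t k] p in \<open>simp_all only: of_nat_le_iff mult_nonneg_nonneg\<close>)
  finally show ?thesis by (simp add: power2_eq_square)
qed

lemma unpackable_prob_Suc_le:
  assumes p: "0 \<le> p" "p \<le> 1"
    and r: "r = Suc l * j" "0 < r" "h * D < t div r"
  shows "unpackable_prob (Suc t) (Suc l) p \<le> unpackable_prob t (Suc l) p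
     + 2 * (t * (exp (p * t ^ l) / 2 ^ Suc d) + t ^ l * (exp (p * t) / 2 ^ Suc D))
     + (r * ((1 - (1 - p) ^ (2 * d)) ^ m + ((1 + p) ^ (2 * d)) ^ m / 2 ^ h) + exp (p * p * t ^ l) / 2 ^ j)"
proof -
  let ?G = "random_hypergraph t (Suc l) p"
  let ?M = "random_hypergraph_pair t (Suc l) p p"
  let ?N = "random_hypergraph_pair t l p p"
  define NP where "NP = {(G1, G2). \<not> packable {..<t} G1 {..<t} (G2 :: nat set set)}"
  let ?bad = "{H. \<not> bounded_degrees t l d D H}"
  define \<delta> where "\<delta> = r * ((1 - (1 - p) ^ (2 * d)) ^ m + ((1 + p) ^ (2 * d)) ^ m / 2 ^ h)
     + exp (p * p * real t ^ l) / 2 ^ j"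
  define E where "E = {((H1, H2), (A, B)). \<not> packable {..<Suc t} (H1 \<union> insert t ` A) {..<Suc t} (H2 \<union> insert t ` B)}"
  have "(1 - p) ^ (2 * d) \<le> 1" by (rule power_le_one) (use p in auto)
  hence \<delta>: "0 \<le> \<delta>" using p unfolding \<delta>_def by (intro add_nonneg_nonneg mult_nonneg_nonneg) auto
  have M: "?M = pair_pmf ?G ?G" by (simp add: random_hypergraph_pair_def)
  have fin: "finite (set_pmf ?M)"
    unfolding M by (simp add: random_hypergraph_eq finite_set_random_subset)
  have "unpackable_prob (Suc t) (Suc l) p = measure_pmf.prob (pair_pmf ?M ?N) E"
    unfolding unpackable_prob_def random_hypergraph_pair_Suc measure_map_pmf
    by (rule arg_cong[where f = "measure_pmf.prob (pair_pmf ?M ?N)"]) (auto simp: E_def)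
  also have "\<dots> = measure_pmf.expectation ?M (\<lambda>x. measure_pmf.prob ?N {y. (x, y) \<in> E})"
    by (rule prob_pair_pmf)
  also have "\<dots> \<le> measure_pmf.expectation ?M
      (\<lambda>x. indicator NP x + indicator (?bad \<times> UNIV) x + indicator (UNIV \<times> ?bad) x + \<delta>)"
  proof (rule integral_mono_AE)
    show "AE x in ?M. measure_pmf.prob ?N {y. (x, y) \<in> E}
       \<le> indicator NP x + indicator (?bad \<times> UNIV) x + indicator (UNIV \<times> ?bad) x + \<delta>"
    proof (rule AE_pmfI)
      fix x assume x: "x \<in> set_pmf ?M"
      obtain H1 H2 where xH: "x = (H1, H2)" by (cases x)
      have sub: "H1 \<subseteq> k_subsets t (Suc l)" "H2 \<subseteq> k_subsets t (Suc l)"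
        using x set_random_subset[of "k_subsets t (Suc l)" p] unfolding M xH random_hypergraph_eq by auto
      show "measure_pmf.prob ?N {y. (x, y) \<in> E}
         \<le> indicator NP x + indicator (?bad \<times> UNIV) x + indicator (UNIV \<times> ?bad) x + \<delta>"
      proof (cases "packable {..<t} H1 {..<t} H2 \<and> bounded_degrees t l d D H1 \<and> bounded_degrees t l d D H2")
        case True
        have "{y. (x, y) \<in> E} = {(A, B). \<not> packable {..<Suc t} (H1 \<union> insert t ` A) {..<Suc t} (H2 \<union> insert t ` B)}"
          by (auto simp: E_def xH)
        hence "measure_pmf.prob ?N {y. (x, y) \<in> E} \<le> \<delta>"
          using extension_failure_prob[OF p sub _ _ _ r, of d m] True by (simp add: \<delta>_def)
        moreover have "0 \<le> indicator NP x + indicator (?bad \<times> UNIV) x + (indicator (UNIV \<times> ?bad) x :: real)"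
          by simp
        ultimately show ?thesis by linarith
      next
        case False
        hence "1 \<le> indicator NP x + indicator (?bad \<times> UNIV) x + (indicator (UNIV \<times> ?bad) x :: real)"
          by (auto simp: xH indicator_def NP_def)
        moreover have "measure_pmf.prob ?N {y. (x, y) \<in> E} \<le> 1" by simp
        ultimately show ?thesis using \<delta> by linarith
      qed
    qed
  qed (intro integrable_measure_pmf_finite fin)+
  also have "\<dots> = measure_pmf.prob ?M NP + measure_pmf.prob ?M (?bad \<times> UNIV) + measure_pmf.prob ?M (UNIV \<times> ?bad) + \<delta>"
    by (simp add: integrable_measure_pmf_finite[OF fin] del: indicator_simps)
  also have "measure_pmf.prob ?M (?bad \<times> UNIV) = measure_pmf.prob (map_pmf fst ?M) ?bad"
    unfolding measure_map_pmf by (rule arg_cong[where f = "measure_pmf.prob ?M"]) auto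
  also have "map_pmf fst ?M = ?G" by (simp add: M map_fst_pair_pmf)
  also have "measure_pmf.prob ?M (UNIV \<times> ?bad) = measure_pmf.prob (map_pmf snd ?M) ?bad"
    unfolding measure_map_pmf by (rule arg_cong[where f = "measure_pmf.prob ?M"]) auto
  also have "map_pmf snd ?M = ?G" by (simp add: M map_snd_pair_pmf)
  also have "measure_pmf.prob ?M NP = unpackable_prob t (Suc l) p"
    by (simp add: NP_def unpackable_prob_def)
  finally have *: "unpackable_prob (Suc t) (Suc l) p
      \<le> unpackable_prob t (Suc l) p + measure_pmf.prob ?G ?bad + measure_pmf.prob ?G ?bad + \<delta>" .
  define \<epsilon> where "\<epsilon> = t * (exp (p * real t ^ l) / 2 ^ Suc d) + real t ^ l * (exp (p * t) / 2 ^ Suc D)"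
  have "measure_pmf.prob ?G ?bad \<le> \<epsilon>"
    unfolding \<epsilon>_def by (rule unbounded_degrees_prob[OF p])
  with * have "unpackable_prob (Suc t) (Suc l) p \<le> unpackable_prob t (Suc l) p + 2 * \<epsilon> + \<delta>"
    by linarith
  thus ?thesis unfolding \<epsilon>_def \<delta>_def .
qed

section \<open>Sparse hypergraphs can be packed\<close>

lemma inverse_power2_le_exp:
  assumes "y \<le> real h"
  shows "1 / 2 ^ h \<le> exp (- (2 / 3) * y)"
proof -
  have "(2 / 3) * y \<le> h * ln 2"
    using mult_mono[OF assms ln2_ge_two_thirds] by (simp add: mult.commute)
  hence "exp (2 / 3 * y) \<le> exp (h * ln 2)" by simp
  also have "\<dots> = 2 ^ h" by (simp add: exp_of_nat_mult)
  finally show ?thesis by (simp add: exp_minus field_simps)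
qed

lemma nat_ceiling_bounds:
  assumes "0 \<le> (y::real)"
  shows "y \<le> real (nat \<lceil>y\<rceil>)" "real (nat \<lceil>y\<rceil>) \<le> y + 1"
  using assms by linarith+

lemma one_minus_ge_exp:
  assumes "0 \<le> (p::real)" "p \<le> 1 / 2"
  shows "exp (- (2 * p)) \<le> 1 - p"
proof -
  have "1 \<le> (1 - p) * (1 + 2 * p)" using mult_nonneg_nonneg[of p "1 - 2 * p"] assms
    by (simp add: algebra_simps)
  also have "\<dots> \<le> (1 - p) * exp (2 * p)" using assms by (intro mult_left_mono) auto
  finally show ?thesis by (simp add: exp_minus field_simps)
qed

text \<open>
  The error of a single extension for \<open>k = l + 1\<close> after all parameters have been fixed, see
  \<open>unpackable_prob_step\<close>. Its summands come, in this order, from large vertex degrees, large degrees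
  of \<open>l\<close>-sets, failure of all tests, too many elements found in the tests, and too many conflicts
  between new edges.
\<close>

definition step_error :: "nat \<Rightarrow> nat \<Rightarrow> real" where
  "step_error l n =
     2 * (real n * exp (- (sqrt (ln (real n) * real n) / 20)) + real n ^ l * exp (- (2 / 3 * real n powr 0.05)))
     + (real (Suc l) * (real n powr 0.02 + 1) *
          (exp (- (exp (-2) * real n powr 0.07))
           + exp ((0.015 * ln (real n) + 1) * (real n powr 0.1 + 1) - 2 / 3 * real n powr 0.15))
        + exp (ln (real n) / 400 - 2 / 3 * real n powr 0.02))"

text \<open>
  An upper bound, as a fraction of \<open>t\<close>, for the number \<open>r * (h * D + 1)\<close> of old vertices that suffices for
  the candidates in every residue class not to be exhausted.
\<close>

definition congestion :: "nat \<Rightarrow> nat \<Rightarrow> real" where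
  "congestion l n = ((real n powr 0.15 + 1) * (3 * (sqrt (ln (real n) / real n) / 20) + (real n powr 0.05 + 1) / real n powr 0.45)
      + 1 / real n powr 0.45) * (real (Suc l) * (real n powr 0.02 + 1))"

lemma eventually_congestion_le_1: "eventually (\<lambda>n. congestion l n \<le> 1) sequentially"
proof -
  have "(congestion l \<longlongrightarrow> 0) sequentially" unfolding congestion_def by real_asymp
  thus ?thesis by (rule eventually_mono[OF order_tendstoD(2)[of _ _ _ 1]]) auto
qed

lemma step_error_tendsto: "(\<lambda>n. real n * step_error l n) \<longlonglongrightarrow> 0"
proof -
  have 1: "(\<lambda>n. real n * (real n * exp (- (sqrt (ln (real n) * real n) / 20)))) \<longlonglongrightarrow> 0"
    by real_asymp
  have 2: "(\<lambda>n. real n * (real n ^ l * exp (- (2 / 3 * real n powr 0.05)))) \<longlonglongrightarrow> 0"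
    by real_asymp
  have 3: "(\<lambda>n. real n * ((real n powr 0.02 + 1) * exp (- (exp (-2) * real n powr 0.07)))) \<longlonglongrightarrow> 0"
    by real_asymp
  have 4: "(\<lambda>n. real n * ((real n powr 0.02 + 1) * exp ((0.015 * ln (real n) + 1) * (real n powr 0.1 + 1) - 2 / 3 * real n powr 0.15))) \<longlonglongrightarrow> 0"
    by real_asymp
  have 5: "(\<lambda>n. real n * exp (ln (real n) / 400 - 2 / 3 * real n powr 0.02)) \<longlonglongrightarrow> 0"
    by real_asymp
  have "(\<lambda>n. 2 * (real n * (real n * exp (- (sqrt (ln (real n) * real n) / 20)))
        + real n * (real n ^ l * exp (- (2 / 3 * real n powr 0.05))))
      + (real (Suc l) * (real n * ((real n powr 0.02 + 1) * exp (- (exp (-2) * real n powr 0.07)))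
           + real n * ((real n powr 0.02 + 1) * exp ((0.015 * ln (real n) + 1) * (real n powr 0.1 + 1) - 2 / 3 * real n powr 0.15)))
        + real n * exp (ln (real n) / 400 - 2 / 3 * real n powr 0.02)))
     \<longlonglongrightarrow> 2 * (0 + 0) + (real (Suc l) * (0 + 0) + 0)"
    by (intro tendsto_intros 1 2 3 4 5)
  also have "2 * (0 + 0) + (real (Suc l) * (0 + 0) + 0) = 0" by simp
  finally show ?thesis unfolding step_error_def by (simp only: distrib_left distrib_right mult.assoc mult.left_commute)
qed

text \<open>
  With \<open>x = P n ^ l\<close>, which bounds the expected vertex degree, one has \<open>P x = ln n / 400\<close>. Vertex degrees are
  below \<open>d \<approx> 3 x\<close>, so a vertex has at most \<open>6 x\<close> obstacles up to rounding and avoids them all with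
  probability at least \<open>exp (- 2 P * 6 x) = n powr (-0.03)\<close> up to a constant. Hence
  \<open>m \<approx> n powr 0.1\<close> tests suffice. They find about \<open>n powr 0.1 * ln n\<close> elements, well below
  \<open>h \<approx> n powr 0.15\<close>. The degrees of \<open>l\<close>-sets have mean at most \<open>P t\<close>, which can be less than 1; therefore the
  term \<open>n powr 0.05\<close> is added in \<open>D\<close> to make the tail bound small. Finally \<open>j \<approx> n powr 0.02\<close> exceeds the mean
  \<open>ln n / 400\<close> of the number of conflicts between new edges.
\<close>

lemma unpackable_prob_step:
  fixes n t l :: nat and p :: real
  defines "P \<equiv> sqrt (ln (real n) / real n ^ l) / 20"
  assumes l: "1 \<le> l" and n: "2 \<le> n" and p: "0 \<le> p" "p \<le> P" and P: "P \<le> 1 / 2"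
    and congestion: "congestion l n \<le> 1" and t: "real n powr 0.45 \<le> real t" "t < n"
  shows "unpackable_prob (Suc t) (Suc l) p \<le> unpackable_prob t (Suc l) p + step_error l n"
proof -
  define x where "x = P * real n ^ l"
  define d where "d = nat \<lceil>3 * x\<rceil>"
  define D where "D = nat \<lceil>3 * P * t + real n powr 0.05\<rceil>"
  define m where "m = nat \<lceil>real n powr 0.1\<rceil>"
  define h where "h = nat \<lceil>real n powr 0.15\<rceil>"
  define j where "j = nat \<lceil>real n powr 0.02\<rceil>"
  define r where "r = Suc l * j"
  have n1: "1 \<le> real n" and lnn: "0 \<le> ln (real n)" using n by auto
  have P0: "0 \<le> P" using lnn by (simp add: P_def)
  have x0: "0 \<le> x" using P0 by (simp add: x_def)
  have PP: "P * P * real n ^ l = ln (real n) / 400"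
    using lnn n by (simp add: P_def field_simps)
  hence Px: "P * x = ln (real n) / 400" by (simp add: x_def)
  have nl: "real n \<le> real n ^ l" using l n1 by (simp add: self_le_power)
  have P_le: "P \<le> sqrt (ln (real n) / real n) / 20"
    unfolding P_def using lnn nl n1 by (intro divide_right_mono real_sqrt_le_mono divide_left_mono) auto
  have x_ge: "sqrt (ln (real n) * real n) / 20 \<le> x"
  proof -
    have "x = sqrt (ln (real n) / real n ^ l) * sqrt (real n ^ l * real n ^ l) / 20"
      unfolding x_def P_def by simp
    also have "\<dots> = sqrt (ln (real n) / real n ^ l * (real n ^ l * real n ^ l)) / 20"
      by (simp only: real_sqrt_mult)
    also have "ln (real n) / real n ^ l * (real n ^ l * real n ^ l) = ln (real n) * real n ^ l"
      using n by simp
    finally show ?thesis using lnn nl by (simp add: mult_left_mono)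
  qed
  have d: "3 * x \<le> real d" "real d \<le> 3 * x + 1" unfolding d_def by (rule nat_ceiling_bounds; use x0 in simp)+
  have D: "3 * P * t + real n powr 0.05 \<le> real D" "real D \<le> 3 * P * t + real n powr 0.05 + 1"
    unfolding D_def by (rule nat_ceiling_bounds; use P0 in simp)+
  have m: "real n powr 0.1 \<le> real m" "real m \<le> real n powr 0.1 + 1"
    unfolding m_def by (rule nat_ceiling_bounds; simp)+
  have h: "real n powr 0.15 \<le> real h" "real h \<le> real n powr 0.15 + 1"
    unfolding h_def by (rule nat_ceiling_bounds; simp)+
  have j: "real n powr 0.02 \<le> real j" "real j \<le> real n powr 0.02 + 1"
    unfolding j_def by (rule nat_ceiling_bounds; simp)+
  have r: "real r \<le> real (Suc l) * (real n powr 0.02 + 1)"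
    unfolding r_def of_nat_mult using j by (intro mult_left_mono) auto
  have "1 \<le> real n powr 0.02" using n1 by (simp add: ge_one_powr_ge_zero)
  hence "1 \<le> j" using j(1) by linarith
  hence r0: "0 < r" by (simp add: r_def)
  have t0: "0 < real n powr 0.45" using n by simp
  hence t_pos: "0 < real t" using t by linarith
  have tn: "real t \<le> real n" using t by simp
  have tl: "real t ^ l \<le> real n ^ l" by (rule power_mono) (use tn in auto)
  have p1: "p \<le> 1" "p \<le> 1 / 2" using p P by auto

  have fits: "h * D < t div r"
  proof -
    have "real ((h * D + 1) * r) \<le> ((real n powr 0.15 + 1) * (3 * P * t + real n powr 0.05 + 1) + 1)
        * (real (Suc l) * (real n powr 0.02 + 1))"
      unfolding of_nat_mult of_nat_add of_nat_1
      using h D r P0 by (intro mult_mono add_mono) auto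
    also have "\<dots> \<le> ((real n powr 0.15 + 1) * (3 * (sqrt (ln (real n) / real n) / 20) * t
          + (real n powr 0.05 + 1) / real n powr 0.45 * t) + 1 / real n powr 0.45 * t)
        * (real (Suc l) * (real n powr 0.02 + 1))"
    proof -
      have *: "c \<le> c / real n powr 0.45 * t" if "0 \<le> c" for c
        using mult_left_mono[OF t(1) that] t0 by (simp add: field_simps)
      have "3 * P * t \<le> 3 * (sqrt (ln (real n) / real n) / 20) * t"
        using P_le by (intro mult_right_mono) auto
      moreover have "real n powr 0.05 + 1 \<le> (real n powr 0.05 + 1) / real n powr 0.45 * t" by (rule *) simp
      ultimately have "3 * P * t + real n powr 0.05 + 1 \<le> 3 * (sqrt (ln (real n) / real n) / 20) * t
          + (real n powr 0.05 + 1) / real n powr 0.45 * t" by linarith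
      hence "(real n powr 0.15 + 1) * (3 * P * t + real n powr 0.05 + 1)
         \<le> (real n powr 0.15 + 1) * (3 * (sqrt (ln (real n) / real n) / 20) * t
          + (real n powr 0.05 + 1) / real n powr 0.45 * t)"
        by (rule mult_left_mono) simp
      hence "(real n powr 0.15 + 1) * (3 * P * t + real n powr 0.05 + 1) + 1
         \<le> (real n powr 0.15 + 1) * (3 * (sqrt (ln (real n) / real n) / 20) * t
          + (real n powr 0.05 + 1) / real n powr 0.45 * t) + 1 / real n powr 0.45 * t"
        by (rule add_mono) (rule *, simp)
      thus ?thesis by (rule mult_right_mono) simp
    qed
    also have "\<dots> = congestion l n * t" by (simp add: congestion_def algebra_simps)
    also have "\<dots> \<le> 1 * real t" using congestion by (intro mult_right_mono) auto
    finally have "(h * D + 1) * r \<le> t" by (simp only: mult_1 of_nat_le_iff)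
    hence "h * D + 1 \<le> t div r" using r0 by (simp add: less_eq_div_iff_mult_less_eq)
    thus ?thesis by simp
  qed

  have E1: "t * (exp (p * real t ^ l) / 2 ^ Suc d) \<le> real n * exp (- (sqrt (ln (real n) * real n) / 20))"
  proof -
    have "p * real t ^ l \<le> x" unfolding x_def using p tl P0 by (auto intro: mult_mono)
    moreover have "1 / 2 ^ Suc d \<le> exp (- (2 / 3) * (3 * x))"
      by (rule inverse_power2_le_exp) (use d in auto)
    ultimately have "exp (p * real t ^ l) * (1 / 2 ^ Suc d) \<le> exp x * exp (- (2 / 3) * (3 * x))"
      by (intro mult_mono) auto
    also have "\<dots> = exp (- x)" by (simp add: mult_exp_exp)
    also have "\<dots> \<le> exp (- (sqrt (ln (real n) * real n) / 20))" using x_ge by simp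
    finally have "exp (p * real t ^ l) / 2 ^ Suc d \<le> exp (- (sqrt (ln (real n) * real n) / 20))" by simp
    thus ?thesis using tn by (intro mult_mono) auto
  qed
  have E2: "real t ^ l * (exp (p * t) / 2 ^ Suc D) \<le> real n ^ l * exp (- (2 / 3 * real n powr 0.05))"
  proof -
    have "p * t \<le> P * t" using p by (intro mult_right_mono) auto
    moreover have "1 / 2 ^ Suc D \<le> exp (- (2 / 3) * (3 * P * t + real n powr 0.05))"
      by (rule inverse_power2_le_exp) (use D in auto)
    ultimately have "exp (p * t) * (1 / 2 ^ Suc D) \<le> exp (P * t) * exp (- (2 / 3) * (3 * P * t + real n powr 0.05))"
      by (intro mult_mono) auto
    also have "\<dots> = exp (- (P * t) - 2 / 3 * real n powr 0.05)" by (simp add: mult_exp_exp algebra_simps)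
    also have "\<dots> \<le> exp (- (2 / 3 * real n powr 0.05))" using P0 by simp
    finally have "exp (p * t) / 2 ^ Suc D \<le> exp (- (2 / 3 * real n powr 0.05))" by simp
    thus ?thesis using tl by (intro mult_mono) auto
  qed
  have pd: "p * real (2 * d) \<le> 6 * (ln (real n) / 400) + 1"
  proof -
    have "p * real (2 * d) \<le> P * (2 * (3 * x + 1))" using p d x0 P0 by (intro mult_mono) auto
    also have "\<dots> = 6 * (P * x) + 2 * P" by (simp add: algebra_simps)
    finally show ?thesis using P Px by simp
  qed
  have E3: "(1 - (1 - p) ^ (2 * d)) ^ m \<le> exp (- (exp (-2) * real n powr 0.07))"
  proof -
    define q where "q = (1 - p) ^ (2 * d)"
    have q01: "0 \<le> q" "q \<le> 1" unfolding q_def using p p1 by (auto intro: power_le_one)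
    have "exp (-2) * real n powr (-0.03) = exp (- 2 - 0.03 * ln (real n))"
      using n by (simp add: powr_def mult_exp_exp)
    also have "\<dots> \<le> exp (real (2 * d) * (- (2 * p)))" using pd by (simp add: algebra_simps)
    also have "\<dots> = exp (- (2 * p)) ^ (2 * d)" by (rule exp_of_nat_mult)
    also have "\<dots> \<le> q" unfolding q_def
      by (intro power_mono one_minus_ge_exp p p1) auto
    finally have q: "exp (-2) * real n powr (-0.03) \<le> q" .
    have "(1 - q) ^ m \<le> exp (- q) ^ m"
      using exp_ge_add_one_self[of "- q"] q01 by (intro power_mono) auto
    also have "\<dots> = exp (- (q * m))" by (simp add: exp_of_nat_mult[symmetric] mult.commute)
    also have "\<dots> \<le> exp (- (exp (-2) * real n powr 0.07))"
    proof -
      have "exp (-2) * real n powr 0.07 = exp (-2) * real n powr (-0.03) * real n powr 0.1"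
        by (simp add: powr_add[symmetric])
      also have "\<dots> \<le> q * m" using q q01 m by (intro mult_mono) auto
      finally show ?thesis by simp
    qed
    finally show ?thesis by (simp add: q_def)
  qed
  have E4: "((1 + p) ^ (2 * d)) ^ m / 2 ^ h
      \<le> exp ((0.015 * ln (real n) + 1) * (real n powr 0.1 + 1) - 2 / 3 * real n powr 0.15)"
  proof -
    have "((1 + p) ^ (2 * d)) ^ m \<le> (exp p ^ (2 * d)) ^ m" using p by (intro power_mono) auto
    also have "\<dots> = exp (p * real (2 * d) * m)" by (simp only: exp_of_nat_mult[symmetric] mult.commute mult.assoc)
    also have "p * real (2 * d) * m \<le> (0.015 * ln (real n) + 1) * (real n powr 0.1 + 1)"
      using pd m p lnn by (intro mult_mono) auto
    finally have "((1 + p) ^ (2 * d)) ^ m \<le> exp ((0.015 * ln (real n) + 1) * (real n powr 0.1 + 1))" by simp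
    hence "((1 + p) ^ (2 * d)) ^ m * (1 / 2 ^ h) \<le> exp ((0.015 * ln (real n) + 1) * (real n powr 0.1 + 1))
        * exp (- (2 / 3) * real n powr 0.15)"
      using inverse_power2_le_exp[OF h(1)] by (intro mult_mono) auto
    thus ?thesis by (simp add: mult_exp_exp)
  qed
  have E5: "exp (p * p * real t ^ l) / 2 ^ j \<le> exp (ln (real n) / 400 - 2 / 3 * real n powr 0.02)"
  proof -
    have "p * p * real t ^ l \<le> P * P * real n ^ l"
      using p P0 tl by (simp add: mult_mono)
    hence "exp (p * p * real t ^ l) * (1 / 2 ^ j) \<le> exp (ln (real n) / 400) * exp (- (2 / 3) * real n powr 0.02)"
      using inverse_power2_le_exp[OF j(1)] PP by (intro mult_mono) auto
    thus ?thesis by (simp add: mult_exp_exp)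
  qed
  have "(1 - p) ^ (2 * d) \<le> 1" using p p1 by (intro power_le_one) auto
  hence E34: "r * ((1 - (1 - p) ^ (2 * d)) ^ m + ((1 + p) ^ (2 * d)) ^ m / 2 ^ h)
     \<le> real (Suc l) * (real n powr 0.02 + 1) *
          (exp (- (exp (-2) * real n powr 0.07))
           + exp ((0.015 * ln (real n) + 1) * (real n powr 0.1 + 1) - 2 / 3 * real n powr 0.15))"
    using r E3 E4 p by (intro mult_mono add_mono add_nonneg_nonneg) auto
  have "unpackable_prob (Suc t) (Suc l) p \<le> unpackable_prob t (Suc l) p
     + 2 * (t * (exp (p * real t ^ l) / 2 ^ Suc d) + real t ^ l * (exp (p * t) / 2 ^ Suc D))
     + (r * ((1 - (1 - p) ^ (2 * d)) ^ m + ((1 + p) ^ (2 * d)) ^ m / 2 ^ h) + exp (p * p * real t ^ l) / 2 ^ j)"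
    by (rule unpackable_prob_Suc_le[OF p(1) p1(1) r_def r0 fits])
  also have "\<dots> \<le> unpackable_prob t (Suc l) p + step_error l n"
    unfolding step_error_def add.assoc[symmetric, of "unpackable_prob t (Suc l) p"]
    by (intro add_mono mult_left_mono E1 E2 E34 E5 order_refl) simp
  finally show ?thesis .
qed

text \<open>
  The exponent \<open>0.45\<close> for the starting size is a compromise. The identity packs the first
  \<open>s\<close> vertices with high probability if \<open>s ^ (l + 1) P\<^sup>2\<close> is small, which for \<open>l = 1\<close> requires an exponent
  below \<open>1/2\<close>; the tests above need \<open>s\<close> to exceed about \<open>h\<close> times \<open>n powr 0.05\<close>.
\<close>

lemma unpackable_prob_sparse_le:
  fixes n l :: nat and p :: real
  defines "P \<equiv> sqrt (ln (real n) / real n ^ l) / 20"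
  assumes l: "1 \<le> l" and n: "2 \<le> n" and p: "0 \<le> p" "p \<le> P" and P: "P \<le> 1 / 2"
    and congestion: "congestion l n \<le> 1"
  shows "unpackable_prob n (Suc l) p
     \<le> 2 ^ Suc l / 400 * (ln (real n) / real n powr 0.1) + real n * step_error l n"
proof -
  define s where "s = nat \<lceil>real n powr 0.45\<rceil>"
  have n1: "1 \<le> real n" and lnn: "0 \<le> ln (real n)" using n by auto
  have s: "real n powr 0.45 \<le> real s" "real s \<le> real n powr 0.45 + 1"
    unfolding s_def by (rule nat_ceiling_bounds; simp)+
  have p1: "p \<le> 1" using p P by simp
  have err: "0 \<le> step_error l n"
    using lnn by (auto simp: step_error_def)
  have "real n powr 0.45 \<le> real n powr 1" using n1 by (intro powr_mono) auto
  hence sn: "s \<le> n" unfolding s_def using n by (simp add: nat_le_iff ceiling_le_iff)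
  have "unpackable_prob (s + i) (Suc l) p \<le> unpackable_prob s (Suc l) p + i * step_error l n" if "s + i \<le> n" for i
    using that
  proof (induction i)
    case (Suc i)
    have "unpackable_prob (Suc (s + i)) (Suc l) p \<le> unpackable_prob (s + i) (Suc l) p + step_error l n"
      by (rule unpackable_prob_step) (use l n p P congestion s Suc.prems in \<open>auto simp: P_def\<close>)
    moreover have "unpackable_prob (s + i) (Suc l) p \<le> unpackable_prob s (Suc l) p + i * step_error l n"
      using Suc by simp
    ultimately show ?case by (simp add: algebra_simps)
  qed simp
  from this[of "n - s"] sn
  have "unpackable_prob n (Suc l) p \<le> unpackable_prob s (Suc l) p + real (n - s) * step_error l n" by simp
  also have "real (n - s) * step_error l n \<le> real n * step_error l n"
    using err by (intro mult_right_mono) auto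
  also have "unpackable_prob s (Suc l) p \<le> real s ^ Suc l * p\<^sup>2" by (rule unpackable_prob_le[OF p(1) p1])
  also have "real s ^ Suc l * p\<^sup>2 \<le> (2 * real n powr 0.45) ^ Suc l * P\<^sup>2"
  proof -
    have "1 \<le> real n powr 0.45" using n1 by (simp add: ge_one_powr_ge_zero)
    hence "real s \<le> 2 * real n powr 0.45" using s by linarith
    hence "real s ^ Suc l \<le> (2 * real n powr 0.45) ^ Suc l" by (intro power_mono) auto
    moreover have "p\<^sup>2 \<le> P\<^sup>2" using p by (intro power_mono)
    ultimately show ?thesis by (simp only: of_nat_power mult_mono zero_le_power2 zero_le_power powr_ge_zero mult_nonneg_nonneg zero_le_numeral)
  qed
  also have "P\<^sup>2 = ln (real n) / 400 / real n ^ l"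
    using lnn by (simp add: P_def power_divide)
  also have "(2 * real n powr 0.45) ^ Suc l * (ln (real n) / 400 / real n ^ l)
      = 2 ^ Suc l / 400 * ln (real n) * (real n powr 0.45 * (real n powr 0.45 / real n) ^ l)"
    by (simp add: power_mult_distrib power_divide)
  also have "real n powr 0.45 / real n = real n powr (-0.55)"
    using n powr_diff[of "real n" "0.45" 1] by simp
  also have "(real n powr (-0.55)) ^ l \<le> (real n powr (-0.55)) ^ 1"
  proof (rule power_decreasing[OF l])
    show "real n powr (-0.55) \<le> 1" using powr_mono[of "-0.55" 0 "real n"] n1 by simp
  qed simp
  also have "real n powr 0.45 * (real n powr (-0.55)) ^ 1 = real n powr (-0.1)"
    by (simp add: powr_add[symmetric])
  also have "2 ^ Suc l / 400 * ln (real n) * real n powr (-0.1) = 2 ^ Suc l / 400 * (ln (real n) / real n powr 0.1)"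
    by (simp add: powr_minus field_simps)
  finally show ?thesis using lnn by (simp add: mult_left_mono)
qed

lemma unpackable_prob_sparse_tendsto:
  fixes p :: "nat \<Rightarrow> real"
  assumes k: "2 \<le> k" and p: "\<And>n. p n \<in> {0..1}"
    and le: "eventually (\<lambda>n. p n \<le> 1 / 20 * sqrt (ln (real n) / real n ^ (k - 1))) sequentially"
  shows "(\<lambda>n. unpackable_prob n k (p n)) \<longlonglongrightarrow> 0"
proof -
  define l where "l = k - 1"
  have l: "1 \<le> l" "k = Suc l" using k by (auto simp: l_def)
  have "((\<lambda>n. sqrt (ln (real n) / real n) / 20) \<longlongrightarrow> 0) sequentially" by real_asymp
  hence small: "eventually (\<lambda>n. sqrt (ln (real n) / real n) / 20 < 1 / 2) sequentially"
    by (rule order_tendstoD) auto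
  have "(\<lambda>n. ln (real n) / real n powr 0.1) \<longlonglongrightarrow> 0" by real_asymp
  hence "(\<lambda>n. 2 ^ Suc l / 400 * (ln (real n) / real n powr 0.1) + real n * step_error l n) \<longlonglongrightarrow> 2 ^ Suc l / 400 * 0 + 0"
    by (intro tendsto_intros step_error_tendsto)
  hence lim: "(\<lambda>n. 2 ^ Suc l / 400 * (ln (real n) / real n powr 0.1) + real n * step_error l n) \<longlonglongrightarrow> 0" by simp
  have "eventually (\<lambda>n. unpackable_prob n k (p n)
     \<le> 2 ^ Suc l / 400 * (ln (real n) / real n powr 0.1) + real n * step_error l n) sequentially"
    using le small eventually_congestion_le_1[of l] eventually_ge_at_top[of 2]
  proof eventually_elim
    case (elim n)
    have nl: "real n \<le> real n ^ l" using l elim by (simp add: self_le_power)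
    have "sqrt (ln (real n) / real n ^ l) / 20 \<le> sqrt (ln (real n) / real n) / 20"
      using elim nl by (intro divide_right_mono real_sqrt_le_mono divide_left_mono) auto
    hence half: "sqrt (ln (real n) / real n ^ l) / 20 \<le> 1 / 2" using elim by linarith
    show ?case unfolding l(2)
      by (rule unpackable_prob_sparse_le[OF l(1) _ _ _ half]) (use elim l p[of n] in auto)
  qed
  moreover have "eventually (\<lambda>n. 0 \<le> unpackable_prob n k (p n)) sequentially"
    by (simp add: unpackable_prob_def)
  ultimately show ?thesis using lim by (intro tendsto_sandwich[OF _ _ tendsto_const lim])
qed

section \<open>Dense hypergraphs cannot be packed\<close>

text \<open>
  The first-moment bound: by symmetry each permutation is a packing with the same probability as
  the identity.
\<close>

lemma packable_prob_le:
  assumes p: "0 \<le> p" "p \<le> 1" and q: "0 \<le> q" "q \<le> 1"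
  shows "measure_pmf.prob (random_hypergraph_pair n k p q) {(G1, G2). packable {..<n} G1 {..<n} G2}
     \<le> fact n * (1 - p * q) ^ (n choose k)"
proof -
  let ?M = "random_hypergraph_pair n k p q"
  define Z where "Z = k_subsets n k"
  have finZ: "finite Z" by (simp add: Z_def)
  have M: "?M = pair_pmf (random_subset Z p) (random_subset Z q)"
    by (simp add: random_hypergraph_pair_def random_hypergraph_eq Z_def)
  define \<Phi> where "\<Phi> = {\<phi>. \<phi> permutes {..<n}}"
  let ?E = "\<lambda>\<phi>. {(G1, G2). image \<phi> ` G1 \<inter> G2 = {}}"
  have fin\<Phi>: "finite \<Phi>" by (simp add: \<Phi>_def finite_permutations)
  have "measure_pmf.prob ?M {(G1, G2). packable {..<n} G1 {..<n} G2} \<le> measure_pmf.prob ?M (\<Union>\<phi>\<in>\<Phi>. ?E \<phi>)"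
  proof (rule measure_pmf.finite_measure_mono_AE)
    show "AE x in ?M. x \<in> {(G1, G2). packable {..<n} G1 {..<n} G2} \<longrightarrow> x \<in> (\<Union>\<phi>\<in>\<Phi>. ?E \<phi>)"
    proof (intro AE_pmfI impI)
      fix x assume x: "x \<in> set_pmf ?M" "x \<in> {(G1, G2). packable {..<n} G1 {..<n} G2}"
      obtain G1 G2 where [simp]: "x = (G1, G2)" by (cases x)
      have "G1 \<subseteq> Z" using x(1) set_random_subset[of Z p] unfolding M by auto
      hence sub: "e \<subseteq> {..<n}" if "e \<in> G1" for e using that by (auto simp: Z_def k_subsets_def)
      from x(2) obtain \<phi> where \<phi>: "bij_betw \<phi> {..<n} {..<n}" "\<And>e. e \<in> G1 \<Longrightarrow> \<phi> ` e \<notin> G2"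
        by (auto simp: packable_def)
      \<comment> \<open>Only the values of \<open>\<phi>\<close> below \<open>n\<close> matter; this makes it one of finitely many permutations.\<close>
      define \<psi> where "\<psi> v = (if v < n then \<phi> v else v)" for v
      have "bij_betw \<psi> {..<n} {..<n}" using \<phi>(1) by (rule bij_betw_cong[THEN iffD1, rotated]) (simp add: \<psi>_def)
      hence "\<psi> permutes {..<n}" by (rule bij_imp_permutes) (simp add: \<psi>_def)
      moreover have "\<psi> ` e = \<phi> ` e" if "e \<in> G1" for e
        by (rule image_cong[OF refl]) (use sub[OF that] in \<open>auto simp: \<psi>_def\<close>)
      ultimately have "\<psi> \<in> \<Phi>" "image \<psi> ` G1 \<inter> G2 = {}" using \<phi>(2) by (auto simp: \<Phi>_def)
      thus "x \<in> (\<Union>\<phi>\<in>\<Phi>. ?E \<phi>)" by auto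
    qed
  qed auto
  also have "\<dots> \<le> (\<Sum>\<phi>\<in>\<Phi>. measure_pmf.prob ?M (?E \<phi>))"
    by (rule measure_UNION_le) (auto simp: fin\<Phi>)
  also have "\<dots> = (\<Sum>\<phi>\<in>\<Phi>. (1 - p * q) ^ card Z)"
  proof (rule sum.cong[OF refl])
    fix \<phi> assume "\<phi> \<in> \<Phi>"
    hence "bij_betw \<phi> {..<n} {..<n}" by (simp add: \<Phi>_def permutes_imp_bij)
    hence "bij_betw (image \<phi>) Z Z" unfolding Z_def by (rule image_k_subsets)
    hence "measure_pmf.prob ?M (?E \<phi>) = measure_pmf.prob ?M {(A, B). A \<inter> B = {}}"
      unfolding M by (rule random_subset_pair_image[OF finZ])
    also have "\<dots> = (1 - p * q) ^ card Z" unfolding M by (rule random_subset_pair_disjoint_prob[OF finZ p q])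
    finally show "measure_pmf.prob ?M (?E \<phi>) = (1 - p * q) ^ card Z" .
  qed
  also have "\<dots> = fact n * (1 - p * q) ^ (n choose k)"
    by (simp add: Z_def card_k_subsets \<Phi>_def card_permutations)
  finally show ?thesis .
qed

lemma choose_ge:
  assumes "k \<le> n"
  shows "(real n - real k) ^ k / fact k \<le> real (n choose k)"
proof -
  have "(real n - real k) ^ k = (\<Prod>i<k. real n - real k)" by simp
  also have "\<dots> \<le> (\<Prod>i<k. real n - real i)" by (rule prod_mono) (use assms in auto)
  also have "\<dots> = fact k * real (n choose k)"
    by (simp add: binomial_gbinomial gbinomial_prod_rev atLeast0LessThan)
  finally show ?thesis by (simp add: field_simps)
qed

lemma packable_prob_dense_tendsto:
  fixes p q :: "nat \<Rightarrow> real"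
  assumes k: "2 \<le> k" and \<alpha>: "fact k < \<alpha>" and pq: "\<And>n. p n \<in> {0..1} \<and> q n \<in> {0..1}"
    and ge: "eventually (\<lambda>n. \<alpha> * ln (real n) / real n ^ (k - 1) \<le> p n * q n) sequentially"
  shows "(\<lambda>n. measure_pmf.prob (random_hypergraph_pair n k (p n) (q n))
               {(G1, G2). packable {..<n} G1 {..<n} G2}) \<longlonglongrightarrow> 0"
proof -
  \<comment> \<open>Any constant strictly between 1 and \<open>\<alpha> / k!\<close> leaves room for the difference between
    \<open>n choose k\<close> and \<open>n ^ k / k!\<close>.\<close>
  define \<beta> where "\<beta> = (1 + \<alpha> / fact k) / 2"
  have \<beta>: "1 < \<beta>" "\<beta> < \<alpha> / fact k" using \<alpha> by (simp_all add: \<beta>_def field_simps)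
  have "(\<lambda>n. \<alpha> / fact k * (1 - real k / real n) ^ k) \<longlonglongrightarrow> \<alpha> / fact k * (1 - 0) ^ k"
    by (intro tendsto_intros)
  hence "(\<lambda>n. \<alpha> / fact k * (1 - real k / real n) ^ k) \<longlonglongrightarrow> \<alpha> / fact k" by simp
  from order_tendstoD(1)[OF this \<beta>(2)]
  have large: "eventually (\<lambda>n. \<beta> < \<alpha> / fact k * (1 - real k / real n) ^ k) sequentially" .
  have lim: "(\<lambda>n. exp (- ((\<beta> - 1) * (real n * ln (real n))))) \<longlonglongrightarrow> 0"
    using \<beta>(1) by real_asymp
  have upper: "eventually (\<lambda>n. measure_pmf.prob (random_hypergraph_pair n k (p n) (q n))
       {(G1, G2). packable {..<n} G1 {..<n} G2} \<le> exp (- ((\<beta> - 1) * (real n * ln (real n))))) sequentially"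
    using ge large eventually_ge_at_top[of "k + 1"]
  proof eventually_elim
    case (elim n)
    have n: "k \<le> n" "0 < real n" and lnn: "0 \<le> ln (real n)" using elim by auto
    have pq01: "0 \<le> p n * q n" "p n * q n \<le> 1" using pq[of n] by (auto intro: mult_le_one)
    have nk: "real n ^ k = real n * real n ^ (k - 1)" using k by (cases k) auto
    have "\<beta> * (real n * ln (real n)) \<le> \<alpha> / fact k * (1 - real k / real n) ^ k * (real n * ln (real n))"
      using elim lnn by (intro mult_right_mono) auto
    also have "\<dots> = \<alpha> * ln (real n) / real n ^ (k - 1) * ((real n - real k) ^ k / fact k)"
    proof -
      have "1 - real k / real n = (real n - real k) / real n" using n by (simp add: field_simps)
      hence "(1 - real k / real n) ^ k = (real n - real k) ^ k / (real n * real n ^ (k - 1))"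
        by (simp add: power_divide nk)
      thus ?thesis using n by (simp add: mult_ac)
    qed
    also have "\<dots> \<le> p n * q n * real (n choose k)"
      using elim choose_ge[OF n(1)] n pq01 by (intro mult_mono) auto
    finally have main: "\<beta> * (real n * ln (real n)) \<le> p n * q n * real (n choose k)" .
    have "measure_pmf.prob (random_hypergraph_pair n k (p n) (q n)) {(G1, G2). packable {..<n} G1 {..<n} G2}
       \<le> fact n * (1 - p n * q n) ^ (n choose k)"
      by (rule packable_prob_le) (use pq[of n] in auto)
    also have "\<dots> \<le> exp (real n * ln (real n)) * exp (- (p n * q n * real (n choose k)))"
    proof (rule mult_mono)
      have "(fact n :: real) \<le> real n ^ n" using fact_le_power[where 'a = real, of n] by simp
      also have "\<dots> = exp (real n * ln (real n))" using n by (simp add: exp_of_nat_mult)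
      finally show "(fact n :: real) \<le> exp (real n * ln (real n))" .
      have "(1 - p n * q n) ^ (n choose k) \<le> exp (- (p n * q n)) ^ (n choose k)"
        using exp_ge_add_one_self[of "- (p n * q n)"] pq01 by (intro power_mono) auto
      also have "\<dots> = exp (- (p n * q n * real (n choose k)))"
        by (simp add: exp_of_nat_mult[symmetric] mult.commute)
      finally show "(1 - p n * q n) ^ (n choose k) \<le> exp (- (p n * q n * real (n choose k)))" .
    qed (use pq01 in auto)
    also have "\<dots> \<le> exp (- ((\<beta> - 1) * (real n * ln (real n))))"
      using main by (simp add: mult_exp_exp algebra_simps)
    finally show ?case .
  qed
  show ?thesis by (rule tendsto_sandwich[OF _ upper tendsto_const lim]) simp
qed

section \<open>The threshold\<close>

theorem mainTheorem3:
  fixes k :: nat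
  assumes "k \<ge> 2"
  shows
    "(\<forall>(\<alpha>::real) (p::nat \<Rightarrow> real) (q::nat \<Rightarrow> real).
        \<alpha> > fact k \<longrightarrow>
        (\<forall>n. p n \<in> {0..1} \<and> q n \<in> {0..1}) \<longrightarrow>
        (\<forall>\<^sub>F n in sequentially. p n * q n \<ge> \<alpha> * ln (real n) / real n ^ (k - 1)) \<longrightarrow>
        (\<lambda>n. measure_pmf.prob (random_hypergraph_pair n k (p n) (q n))
               {(G1, G2). packable {..<n} G1 {..<n} G2}) \<longlonglongrightarrow> 0)
     \<and>
     (\<exists>(c::real) (C::real). 0 < c \<and> c < C \<and>
        (\<forall>p::nat \<Rightarrow> real. (\<forall>n. p n \<in> {0..1}) \<longrightarrow>
           ((\<forall>\<^sub>F n in sequentially. p n \<le> c * sqrt (ln (real n) / real n ^ (k - 1))) \<longrightarrow>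
              (\<lambda>n. measure_pmf.prob (random_hypergraph_pair n k (p n) (p n))
                     {(G1, G2). packable {..<n} G1 {..<n} G2}) \<longlonglongrightarrow> 1)
         \<and> ((\<forall>\<^sub>F n in sequentially. p n \<ge> C * sqrt (ln (real n) / real n ^ (k - 1))) \<longrightarrow>
              (\<lambda>n. measure_pmf.prob (random_hypergraph_pair n k (p n) (p n))
                     {(G1, G2). \<not> packable {..<n} G1 {..<n} G2}) \<longlonglongrightarrow> 1)))"
proof (intro conjI allI impI)
  fix \<alpha> :: real and p q :: "nat \<Rightarrow> real"
  assume "fact k < \<alpha>" "\<forall>n. p n \<in> {0..1} \<and> q n \<in> {0..1}"
    "\<forall>\<^sub>F n in sequentially. p n * q n \<ge> \<alpha> * ln (real n) / real n ^ (k - 1)"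
  thus "(\<lambda>n. measure_pmf.prob (random_hypergraph_pair n k (p n) (q n))
      {(G1, G2). packable {..<n} G1 {..<n} G2}) \<longlonglongrightarrow> 0"
    using assms by (intro packable_prob_dense_tendsto) auto
next
  let ?C = "sqrt (fact k + 1) :: real"
  have compl: "measure_pmf.prob M {(G1, G2). \<not> packable {..<n} G1 {..<n} G2}
      = 1 - measure_pmf.prob M {(G1, G2). packable {..<n} G1 {..<n} G2}"
    for M :: "(nat set set \<times> nat set set) pmf" and n
  proof -
    have "{(G1, G2). \<not> packable {..<n} G1 {..<n} G2} = UNIV - {(G1, G2). packable {..<n} G1 {..<n} G2}" by auto
    thus ?thesis using measure_pmf.prob_compl[of "{(G1, G2). packable {..<n} G1 {..<n} G2}" M] by simp
  qed
  show "\<exists>(c::real) (C::real). 0 < c \<and> c < C \<and>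
        (\<forall>p::nat \<Rightarrow> real. (\<forall>n. p n \<in> {0..1}) \<longrightarrow>
           ((\<forall>\<^sub>F n in sequentially. p n \<le> c * sqrt (ln (real n) / real n ^ (k - 1))) \<longrightarrow>
              (\<lambda>n. measure_pmf.prob (random_hypergraph_pair n k (p n) (p n))
                     {(G1, G2). packable {..<n} G1 {..<n} G2}) \<longlonglongrightarrow> 1)
         \<and> ((\<forall>\<^sub>F n in sequentially. p n \<ge> C * sqrt (ln (real n) / real n ^ (k - 1))) \<longrightarrow>
              (\<lambda>n. measure_pmf.prob (random_hypergraph_pair n k (p n) (p n))
                     {(G1, G2). \<not> packable {..<n} G1 {..<n} G2}) \<longlonglongrightarrow> 1))"
  \<comment> \<open>\<open>1 / 20\<close> makes the exponent in the probability of a successful test small, and \<open>?C\<^sup>2\<close> exceeds \<open>k!\<close>.\<close>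
  proof (rule exI[of _ "1 / 20"], rule exI[of _ ?C], intro conjI allI impI)
    have "1 \<le> ?C" by simp
    thus "1 / 20 < ?C" by linarith
  next
    fix p :: "nat \<Rightarrow> real"
    assume p: "\<forall>n. p n \<in> {0..1}"
      and le: "\<forall>\<^sub>F n in sequentially. p n \<le> 1 / 20 * sqrt (ln (real n) / real n ^ (k - 1))"
    have "(\<lambda>n. 1 - unpackable_prob n k (p n)) \<longlonglongrightarrow> 1 - 0"
      by (intro tendsto_intros unpackable_prob_sparse_tendsto[OF assms _ le]) (use p in auto)
    thus "(\<lambda>n. measure_pmf.prob (random_hypergraph_pair n k (p n) (p n))
        {(G1, G2). packable {..<n} G1 {..<n} G2}) \<longlonglongrightarrow> 1"
      by (simp add: unpackable_prob_def compl)
  next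
    fix p :: "nat \<Rightarrow> real"
    assume p: "\<forall>n. p n \<in> {0..1}"
      and ge: "\<forall>\<^sub>F n in sequentially. p n \<ge> ?C * sqrt (ln (real n) / real n ^ (k - 1))"
    have "\<forall>\<^sub>F n in sequentially. (fact k + 1) * ln (real n) / real n ^ (k - 1) \<le> p n * p n"
      using ge eventually_ge_at_top[of 1]
    proof eventually_elim
      case (elim n)
      define y where "y = ln (real n) / real n ^ (k - 1)"
      have y: "0 \<le> y" using elim by (simp add: y_def)
      have "(fact k + 1) * y = (?C * sqrt y) * (?C * sqrt y)"
        using y by (simp add: real_sqrt_mult[symmetric] mult.assoc mult.left_commute)
      also have "\<dots> \<le> p n * p n" using elim y p by (intro mult_mono) (auto simp: y_def)
      finally show ?case by (simp add: y_def)
    qed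
    hence "(\<lambda>n. 1 - measure_pmf.prob (random_hypergraph_pair n k (p n) (p n))
        {(G1, G2). packable {..<n} G1 {..<n} G2}) \<longlonglongrightarrow> 1 - 0"
      by (intro tendsto_intros packable_prob_dense_tendsto[OF assms, of "fact k + 1"]) (use p in auto)
    thus "(\<lambda>n. measure_pmf.prob (random_hypergraph_pair n k (p n) (p n))
        {(G1, G2). \<not> packable {..<n} G1 {..<n} G2}) \<longlonglongrightarrow> 1"
      by (simp add: compl)
  qed simp
qed

end
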